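(* Let $a$ be a positive real number with $\log_{10} a\notin\mathbb{Q}$, and let $d\in\{1,2,\dots,9\}$. (i) The Benford prediction for the leading digit $d$ in the sequence $\{a^n\}$ has bounded error (i.e., there is a constant $C$ with $|S_d(N,\{a^n\})-B_d(N)|\le C$ for all $N\in\mathbb{N}$) if and only if $$a^k=\frac{d+1}{d}\,10^m\quad\text{for some } k\in\mathbb{Z}\setminus\{0\}\text{ and } m\in\mathbb{Z}.$$ Moreover, if this condition is satisfied (with integers $k\neq 0$ and $m$), then the limit distribution of the Benford error $E_d(N,\{a^n\})$ exists and is a weighted average of $|k|$ uniform distributions. (ii) The Benford prediction for the leading digit $d$ in $\{a^n\}$ is - a lower perfect hit (i.e., satisfies $S_d(N,\{a^n\})=\lfloor B_d(N)\rfloor$ for all $N\in\mathbb{N}$) if and only if $d=1$ and $a=2\cdot 10^m$ for some $m\in\mathbb{Z}$; - an upper perfect hit (i.e., satisfies $S_d(N,\{a^n\})=\lceil B_d(N)\rceil$ for all $N\in\mathbb{N}$) if and only if $d=9$ and $a=9\cdot 10^m$ for some $m\in\mathbb{Z}$. Moreover, if $d=1$ and $a=2\cdot 10^m$ for some $m\in\mathbb{Z}$, then the limit distribution of the Benford error $E_d(N,\{a^n\})$ exists and is uniform on $[-1,0]$; and if $d=9$ and $a=9\cdot 10^m$ for some $m\in\mathbb{Z}$, then the limit distribution of $E_d(N,\{a^n\})$ exists and is uniform on $[0,1]$.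
   Context: $\mathbb{N}=\{1,2,3,\dots\}$, and "$n\le N$" means $n$ runs over the integers $1,2,\dots,N$. For a real number $x>0$, $D(x)\in\{1,\dots,9\}$ denotes the leading (most significant) decimal digit of $x$, ignoring leading zeros; that is, $D(x)=d$ iff $d\cdot 10^i\le x<(d+1)\cdot 10^i$ for some $i\in\mathbb{Z}$. For a sequence $\{a_n\}_{n\ge1}$ of positive reals, $d\in\{1,\dots,9\}$ and $N\in\mathbb{N}$: $$S_d(N,\{a_n\})=\#\{n\le N: D(a_n)=d\},\qquad B_d(N)=N\log_{10}\left(1+\tfrac1d\right),$$ and the Benford error is $E_d(N,\{a_n\})=S_d(N,\{a_n\})-B_d(N)$. Here $\{a^n\}$ denotes the sequence $a^1,a^2,a^3,\dots$. Limit distribution: a real sequence $\{E(n)\}_{n\ge1}$ has a limit distribution with probability density $f$ if for all real $s<t$, $$\lim_{N\to\infty}\frac1N\#\{n\le N: s\le E(n)<t\}=\int_s^t f(x)\,dx.$$ It is a weighted average of $r$ uniform distributions if $f=\sum_{i=1}^r w_i f_i$ (almost everywhere), where $w_i\ge 0$, $\sum_i w_i=1$, and each $f_i$ is the density of the uniform distribution on some bounded interval of positive length. *)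

theory Defs
  imports "HOL-Analysis.Analysis"
begin

definition has_leading_digit :: "real \<Rightarrow> nat \<Rightarrow> bool" where
  "has_leading_digit x d \<longleftrightarrow> d \<in> {1..9} \<and>
     (\<exists>i::int. real d * 10 powi i \<le> x \<and> x < (real d + 1) * 10 powi i)"

text \<open>Meaningful for \<open>x > 0\<close> only; see \<open>leading_digit_eq_iff\<close> below.\<close>

definition leading_digit :: "real \<Rightarrow> nat" where
  "leading_digit x = (THE d. has_leading_digit x d)"

lemma has_leading_digit_unique:
  assumes "has_leading_digit x d" "has_leading_digit x e"
  shows "d = e"
proof -
  obtain i :: int where i: "real d * 10 powi i \<le> x" "x < (real d + 1) * 10 powi i"
    and d: "1 \<le> d" "d \<le> 9"
    using assms(1) by (auto simp: has_leading_digit_def)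
  obtain j :: int where j: "real e * 10 powi j \<le> x" "x < (real e + 1) * 10 powi j"
    and e: "1 \<le> e" "e \<le> 9"
    using assms(2) by (auto simp: has_leading_digit_def)
  have aux: "i' \<le> j'" if "real d' * 10 powi i' \<le> x" "x < (real e' + 1) * 10 powi j'"
    "1 \<le> d'" "e' \<le> 9" for i' j' :: int and d' e' :: nat
  proof -
    have "(10::real) powi i' = 1 * 10 powi i'" by simp
    also have "\<dots> \<le> real d' * 10 powi i'"
      using that(3) by (intro mult_right_mono) auto
    also have "\<dots> < (real e' + 1) * 10 powi j'" using that by linarith
    also have "\<dots> \<le> 10 * 10 powi j'"
      using that(4) by (intro mult_right_mono) auto
    also have "\<dots> = 10 powi (j' + 1)" by (simp add: power_int_add)
    finally have "(10::real) powi i' < 10 powi (j' + 1)" .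
    hence "i' < j' + 1"
      by (meson not_less one_le_numeral power_int_increasing)
    thus ?thesis by simp
  qed
  have "i = j" using aux[OF i(1) j(2)] aux[OF j(1) i(2)] d e by force
  have p: "(10::real) powi j > 0" by simp
  have "real d * 10 powi j < (real e + 1) * 10 powi j"
       "real e * 10 powi j < (real d + 1) * 10 powi j"
    using i j unfolding \<open>i = j\<close> by linarith+
  hence "real d < real e + 1" "real e < real d + 1"
    using p by (simp_all add: mult_less_cancel_right_pos)
  thus ?thesis by linarith
qed

lemma has_leading_digit_exists:
  assumes "x > 0"
  shows "\<exists>d. has_leading_digit x d"
proof -
  define i where "i = \<lfloor>log 10 x\<rfloor>"
  define p :: real where "p = 10 powi i"
  have p: "p > 0" by (simp add: p_def)
  have p_powr: "p = 10 powr real_of_int i"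
    by (simp add: p_def powr_real_of_int')
  have "p \<le> 10 powr (log 10 x)"
    unfolding p_powr by (intro powr_mono) (auto simp: i_def)
  hence lo: "1 \<le> x / p" using assms p by simp
  have "10 powr (log 10 x) < 10 powr (real_of_int i + 1)"
    by (intro powr_less_mono) (auto simp: i_def)
  hence hi: "x / p < 10" using assms p by (simp add: powr_add p_powr[symmetric] field_simps)
  define d where "d = nat \<lfloor>x / p\<rfloor>"
  have "1 \<le> \<lfloor>x / p\<rfloor>" using lo by simp
  moreover have "\<lfloor>x / p\<rfloor> < 10" using hi by linarith
  ultimately have d: "d \<in> {1..9}" and rd: "real d = of_int \<lfloor>x / p\<rfloor>"
    unfolding d_def atLeastAtMost_iff by linarith+
  have "real d \<le> x / p" "x / p < real d + 1"
    unfolding rd by linarith+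
  hence "real d * p \<le> x" "x < (real d + 1) * p"
    using p by (simp_all add: field_simps)
  thus ?thesis using d unfolding has_leading_digit_def p_def by blast
qed

lemma leading_digit_eq_iff:
  assumes "x > 0"
  shows "leading_digit x = d \<longleftrightarrow> has_leading_digit x d"
proof -
  have "\<exists>!d. has_leading_digit x d"
    using has_leading_digit_exists[OF assms] has_leading_digit_unique by blast
  thus ?thesis unfolding leading_digit_def by (metis theI')
qed

text \<open>Sequences are indexed by the positive integers; the value at \<open>0\<close> is never used.\<close>

definition benford_count :: "nat \<Rightarrow> nat \<Rightarrow> (nat \<Rightarrow> real) \<Rightarrow> nat" where
  "benford_count d N a = card {n \<in> {1..N}. leading_digit (a n) = d}"

definition benford_prediction :: "nat \<Rightarrow> nat \<Rightarrow> real" where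
  "benford_prediction d N = real N * log 10 (1 + 1 / real d)"

definition benford_error :: "nat \<Rightarrow> nat \<Rightarrow> (nat \<Rightarrow> real) \<Rightarrow> real" where
  "benford_error d N a = real (benford_count d N a) - benford_prediction d N"

definition bounded_benford_error :: "nat \<Rightarrow> (nat \<Rightarrow> real) \<Rightarrow> bool" where
  "bounded_benford_error d a \<longleftrightarrow> (\<exists>C. \<forall>N\<ge>1. \<bar>benford_error d N a\<bar> \<le> C)"

definition lower_perfect_hit :: "nat \<Rightarrow> (nat \<Rightarrow> real) \<Rightarrow> bool" where
  "lower_perfect_hit d a \<longleftrightarrow>
     (\<forall>N\<ge>1. int (benford_count d N a) = \<lfloor>benford_prediction d N\<rfloor>)"

definition upper_perfect_hit :: "nat \<Rightarrow> (nat \<Rightarrow> real) \<Rightarrow> bool" where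
  "upper_perfect_hit d a \<longleftrightarrow>
     (\<forall>N\<ge>1. int (benford_count d N a) = \<lceil>benford_prediction d N\<rceil>)"

definition prob_density :: "(real \<Rightarrow> real) \<Rightarrow> bool" where
  "prob_density f \<longleftrightarrow> (\<forall>x. 0 \<le> f x) \<and> has_bochner_integral lborel f 1"

definition has_limit_density :: "(nat \<Rightarrow> real) \<Rightarrow> (real \<Rightarrow> real) \<Rightarrow> bool" where
  "has_limit_density E f \<longleftrightarrow> prob_density f \<and>
     (\<forall>s t. s < t \<longrightarrow>
        (\<lambda>N. real (card {n \<in> {1..N}. s \<le> E n \<and> E n < t}) / real N)
          \<longlonglongrightarrow> (LINT x:{s..t}|lborel. f x))"

definition uniform_density :: "real \<Rightarrow> real \<Rightarrow> real \<Rightarrow> real" where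
  "uniform_density l u x = indicator {l..u} x / (u - l)"

definition weighted_average_of_uniforms :: "nat \<Rightarrow> (real \<Rightarrow> real) \<Rightarrow> bool" where
  "weighted_average_of_uniforms r f \<longleftrightarrow>
     (\<exists>w l u :: nat \<Rightarrow> real.
        (\<forall>i\<in>{1..r}. 0 \<le> w i \<and> l i < u i) \<and> (\<Sum>i=1..r. w i) = 1 \<and>
        (AE x in lborel. f x = (\<Sum>i=1..r. w i * uniform_density (l i) (u i) x)))"

end

theory Submission
  imports Defs "HOL-Analysis.Kronecker_Approximation_Theorem"
begin

text \<open>Write \<open>\<alpha> = log 10 a\<close>, \<open>s = log 10 d\<close> and \<open>l = log 10 (1 + 1/d)\<close>. The power \<open>a ^ n\<close> has leading digit
\<open>d\<close> exactly when \<open>n \<alpha>\<close> lies in the arc \<open>[s, s + l)\<close> of the circle of reals modulo 1, so the Benford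
error is the discrepancy of a single arc along an orbit of the rotation by \<open>\<alpha>\<close>, and everything
depends on the identity
  \<open>arc_indicator s l x - l = frac (x - s - l) - frac (x - s)\<close>.

If \<open>l = k \<alpha> + m\<close>, the right-hand side along the orbit is a difference of the function
\<open>n \<mapsto> frac (n \<alpha> - s)\<close> and its shift by \<open>k\<close> steps. The sum telescopes (\<open>discrepancy_eq_sum_frac\<close>): up
to sign and a constant, the error at \<open>N\<close> is a sum of \<open>\<bar>k\<bar>\<close> sawtooth functions of \<open>N \<alpha>\<close>. Hence it
is bounded. Between consecutive breakpoints the sum of sawtooths is linear, and since \<open>N \<alpha>\<close> is
equidistributed modulo 1, each of the \<open>\<bar>k\<bar>\<close> arcs between breakpoints contributes one uniform
distribution, weighted by the length of the arc (\<open>limit_density_sum_frac\<close>). The same telescoping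
gives the equidistribution, because the lengths \<open>k \<alpha> + m\<close> are dense.

The converse is Kesten's theorem for a single arc (\<open>kesten_arc_length\<close>). Bounded discrepancy yields,
in the manner of Gottschalk and Hedlund, a function \<open>g\<close> on the circle with
\<open>g (x + \<alpha>) = g x - (arc_indicator s l x - l)\<close>. It is continuous from the right, and all its
increments under the rotation are congruent to \<open>l\<close> modulo 1. Translating \<open>x\<close> by a fixed \<open>y\<close> therefore
changes \<open>g x\<close> by an amount whose class modulo 1 is the same for all \<open>x\<close>, first along the orbit and
then, by right-continuity, everywhere. So \<open>g - g 0\<close> is a homomorphism modulo 1; being
right-continuous it is \<open>x \<mapsto> c x\<close> with an integer \<open>c\<close>, and its value at \<open>\<alpha>\<close> gives
\<open>l = c \<alpha> + m\<close>.

A perfect hit says that the successive differences of the counts are those of \<open>\<lfloor>n l\<rfloor>\<close> or of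
\<open>\<lceil>n l\<rceil>\<close>, which are again codings of a rotation by an arc of length \<open>l\<close> starting at \<open>0\<close>. As a
perfect hit has bounded error, \<open>l = k \<alpha> + m\<close>, and the second coding is read along multiples of
\<open>k \<alpha>\<close>. Comparing the first arc with the preimage of the second under multiplication by \<open>\<bar>k\<bar>\<close>,
which consists of \<open>\<bar>k\<bar>\<close> arcs, forces \<open>\<bar>k\<bar> = 1\<close> and determines the position of the arc (\<open>arc_coding_rigid\<close>);
the value at the start of the orbit excludes one sign of \<open>k\<close>.\<close>

section \<open>Arcs and orbits of an irrational rotation\<close>

text \<open>Arcs are half-open, so their indicators are locally constant to the right of every point. Density of
the orbit is therefore needed in this one-sided form: what holds just to the right of \<open>x\<close> holds at
some late point of the orbit.\<close>
lemma orbit_approaches_from_right: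
  fixes \<alpha> x :: real
  assumes "\<alpha> \<notin> \<rat>" and "\<forall>\<^sub>F y in at_right x. P y"
  obtains n :: nat and h :: int where "n \<ge> M" "P (real n * \<alpha> + of_int h)"
proof -
  obtain b where b: "b > x" "\<And>y. x < y \<Longrightarrow> y < b \<Longrightarrow> P y"
    using assms(2) by (auto simp: eventually_at_right_field)
  obtain h k where hk: "k > 0"
    "\<bar>of_int k * \<alpha> - of_int h - ((x + b) / 2 - real M * \<alpha>)\<bar> < (b - x) / 2"
    using sequence_of_fractional_parts_is_dense[OF assms(1), of "(b - x) / 2"] b(1)
    by (metis diff_gt_0_iff_gt half_gt_zero)
  have eq: "real (M + nat k) * \<alpha> + of_int (- h) = real M * \<alpha> + of_int k * \<alpha> - of_int h"
    using hk(1) by (simp add: algebra_simps)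
  have "P (real (M + nat k) * \<alpha> + of_int (- h))"
    unfolding eq using hk(2) by (intro b(2)) (auto simp: abs_less_iff field_simps)
  thus ?thesis using that[of "M + nat k" "- h"] by simp
qed

lemma frac_add_of_int: "frac (x + of_int h) = frac (x :: real)"
  by (simp add: frac_def)

definition arc_indicator :: "real \<Rightarrow> real \<Rightarrow> real \<Rightarrow> real" where
  "arc_indicator s l x = (if frac (x - s) < l then 1 else 0)"

lemma arc_indicator_add_of_int: "arc_indicator s l (x + of_int h) = arc_indicator s l x"
  using frac_add_of_int[of "x - s" h] by (simp add: arc_indicator_def algebra_simps)

text \<open>The identity that makes discrepancies telescope.\<close>
lemma arc_indicator_eq:
  assumes "0 < l" "l < 1"
  shows "arc_indicator s l x = l + frac (x - s - l) - frac (x - s)"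
  using assms frac_diff_pos[of l "x - s"] frac_diff_neg[of "x - s" l]
  by (auto simp: arc_indicator_def frac_eq_id)

lemma eventually_frac_at_right:
  fixes x s :: real
  shows "\<forall>\<^sub>F y in at_right x. frac (y - s) = frac (x - s) + (y - x)"
proof -
  have "frac (y - s) = frac (x - s) + (y - x)" if "x < y" "y < x + (1 - frac (x - s))" for y
    unfolding frac_unique_iff
  proof (intro conjI)
    show "y - s - (frac (x - s) + (y - x)) \<in> \<int>" by (simp add: frac_def)
  qed (use that frac_ge_0[of "x - s"] in linarith)+
  thus ?thesis unfolding eventually_at_right_field using frac_lt_1[of "x - s"]
    by (intro exI[of _ "x + (1 - frac (x - s))"]) simp
qed

lemma eventually_arc_indicator_at_right:
  "\<forall>\<^sub>F y in at_right x. arc_indicator s l y = arc_indicator s l x"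
proof (cases "frac (x - s) < l")
  case True
  have "\<forall>\<^sub>F y in at_right x. y < x + (l - frac (x - s))"
    using True by (auto simp: eventually_at_right_field intro!: exI[of _ "x + (l - frac (x - s))"])
  with eventually_frac_at_right[of s x] show ?thesis
    by eventually_elim (use True in \<open>auto simp: arc_indicator_def\<close>)
next
  case False
  have "\<forall>\<^sub>F y in at_right x. x < y"
    by (simp add: eventually_at_right_less)
  with eventually_frac_at_right[of s x] show ?thesis
    by eventually_elim (use False in \<open>auto simp: arc_indicator_def\<close>)
qed

section \<open>Bounded ergodic sums and their primitives\<close>

text \<open>The ergodic sum of \<open>f\<close> over \<open>n\<close> steps of the rotation, with the sign convention for negative \<open>n\<close>
that makes the cocycle identity hold for all integers. Negative times are needed because suprema over
all integers are transported exactly, not just up to an inequality, by the rotation.\<close>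
definition cocycle :: "(real \<Rightarrow> real) \<Rightarrow> real \<Rightarrow> int \<Rightarrow> real \<Rightarrow> real" where
  "cocycle f \<alpha> n x = (if 0 \<le> n then \<Sum>j\<in>{0..<n}. f (x + of_int j * \<alpha>)
                              else - (\<Sum>j\<in>{n..<0}. f (x + of_int j * \<alpha>)))"

lemma cocycle_0 [simp]: "cocycle f \<alpha> 0 x = 0"
  by (simp add: cocycle_def)

lemma cocycle_step: "cocycle f \<alpha> (n + 1) x = cocycle f \<alpha> n x + f (x + of_int n * \<alpha>)"
proof (cases "0 \<le> n")
  case True
  hence "{0..<n + 1} = insert n {0..<n}" by auto
  thus ?thesis using True by (simp add: cocycle_def)
next
  case False
  hence "{n..<0} = insert n {n + 1..<0}" by auto
  thus ?thesis using False by (auto simp: cocycle_def)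
qed

lemma cocycle_add:
  "cocycle f \<alpha> (n + m) x = cocycle f \<alpha> n x + cocycle f \<alpha> m (x + of_int n * \<alpha>)"
proof (induction m rule: int_induct[where k = 0])
  case base
  show ?case by simp
next
  case (step1 m)
  have "cocycle f \<alpha> (n + (m + 1)) x = cocycle f \<alpha> (n + m) x + f (x + of_int (n + m) * \<alpha>)"
    using cocycle_step[of f \<alpha> "n + m" x] by (simp add: add.assoc)
  with step1 cocycle_step[of f \<alpha> m "x + of_int n * \<alpha>"] show ?case by (simp add: algebra_simps)
next
  case (step2 m)
  have "cocycle f \<alpha> (n + m) x = cocycle f \<alpha> (n + (m - 1)) x + f (x + of_int (n + (m - 1)) * \<alpha>)"
    using cocycle_step[of f \<alpha> "n + (m - 1)" x] by (simp add: algebra_simps)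
  moreover have "cocycle f \<alpha> m (x + of_int n * \<alpha>) = cocycle f \<alpha> (m - 1) (x + of_int n * \<alpha>)
      + f (x + of_int n * \<alpha> + of_int (m - 1) * \<alpha>)"
    using cocycle_step[of f \<alpha> "m - 1" "x + of_int n * \<alpha>"] by simp
  ultimately show ?case using step2 by (simp add: algebra_simps)
qed

lemma cocycle_periodic:
  assumes "\<And>x. f (x + of_int h) = f x"
  shows "cocycle f \<alpha> n (x + of_int h) = cocycle f \<alpha> n x"
proof -
  have "f (x + of_int h + of_int j * \<alpha>) = f (x + of_int j * \<alpha>)" for j :: int
    using assms[of "x + of_int j * \<alpha>"] by (simp add: algebra_simps)
  thus ?thesis by (simp add: cocycle_def)
qed

lemma eventually_cocycle_at_right:
  assumes "\<And>x. \<forall>\<^sub>F y in at_right x. f y = f x"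
  shows "\<forall>\<^sub>F y in at_right x. cocycle f \<alpha> n y = cocycle f \<alpha> n x"
proof -
  have one: "\<forall>\<^sub>F y in at_right x. f (y + c) = f (x + c)" for c
  proof -
    obtain b where b: "b > x + c" "\<And>y. x + c < y \<Longrightarrow> y < b \<Longrightarrow> f y = f (x + c)"
      using assms[of "x + c"] by (auto simp: eventually_at_right_field)
    show ?thesis unfolding eventually_at_right_field
      using b by (intro exI[of _ "b - c"]) auto
  qed
  have "\<forall>\<^sub>F y in at_right x. \<forall>j\<in>{0..<n} \<union> {n..<0}. f (y + of_int j * \<alpha>) = f (x + of_int j * \<alpha>)"
    by (intro eventually_ball_finite) (auto intro: one)
  thus ?thesis by eventually_elim (auto simp: cocycle_def intro!: sum.cong)
qed

lemma Ints_if_approx_Ints: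
  fixes x :: real
  assumes "\<And>\<epsilon>. \<epsilon> > 0 \<Longrightarrow> \<exists>k\<in>\<int>. \<bar>k - x\<bar> < \<epsilon>"
  shows "x \<in> \<int>"
  using closed_Ints[where 'a = real] assms
  by (metis closed_approachable dist_real_def)

text \<open>An ergodic sum started at a point of the orbit is a difference of two sums started at \<open>x\<^sub>0\<close>, and by
local constancy every value of a fixed ergodic sum is attained on the forward orbit.\<close>
lemma bounded_cocycle_if_bounded_on_orbit:
  fixes \<alpha> :: real
  assumes irr: "\<alpha> \<notin> \<rat>"
    and per: "\<And>x h. f (x + of_int h) = f x"
    and loc: "\<And>x. \<forall>\<^sub>F y in at_right x. f y = f x"
    and bd: "\<And>N :: nat. \<bar>cocycle f \<alpha> (int N) x\<^sub>0\<bar> \<le> C"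
  shows "\<bar>cocycle f \<alpha> n x\<bar> \<le> 2 * C"
proof -
  have "\<forall>\<^sub>F y in at_right (x - x\<^sub>0). cocycle f \<alpha> n (x\<^sub>0 + y) = cocycle f \<alpha> n x"
  proof -
    obtain b where "b > x" "\<And>y. x < y \<Longrightarrow> y < b \<Longrightarrow> cocycle f \<alpha> n y = cocycle f \<alpha> n x"
      using eventually_cocycle_at_right[where f = f and x = x and \<alpha> = \<alpha> and n = n, OF loc]
      by (auto simp: eventually_at_right_field)
    thus ?thesis unfolding eventually_at_right_field by (intro exI[of _ "b - x\<^sub>0"]) auto
  qed
  then obtain m h where m: "m \<ge> nat \<bar>n\<bar>"
    "cocycle f \<alpha> n (x\<^sub>0 + (real m * \<alpha> + of_int h)) = cocycle f \<alpha> n x"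
    using orbit_approaches_from_right[OF irr] by blast
  have "cocycle f \<alpha> n x = cocycle f \<alpha> n (x\<^sub>0 + of_int (int m) * \<alpha>)"
    using m(2) cocycle_periodic[of f h \<alpha> n "x\<^sub>0 + real m * \<alpha>", OF per] by (simp add: add.assoc)
  also have "\<dots> = cocycle f \<alpha> (int m + n) x\<^sub>0 - cocycle f \<alpha> (int m) x\<^sub>0"
    using cocycle_add[of f \<alpha> "int m" n x\<^sub>0] by simp
  also have "int m + n = int (nat (int m + n))" using m(1) by linarith
  finally show ?thesis
    using bd[of m] bd[of "nat (int m + n)"] by linarith
qed

text \<open>A one-sided Gottschalk--Hedlund theorem. The supremum \<open>G\<close> and the infimum \<open>H\<close> of the ergodic sums
satisfy the same functional equation, so \<open>G - H\<close> is invariant under the rotation. From the right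
\<open>G\<close> is lower and \<open>H\<close> upper semicontinuous, hence \<open>G - H\<close> is lower semicontinuous; with the orbits
dense, this makes it constant. Then \<open>G\<close> and \<open>H\<close> differ by a constant, and both semicontinuities
together say that \<open>G\<close> is continuous from the right.\<close>
lemma right_continuous_primitive:
  fixes \<alpha> :: real
  assumes irr: "\<alpha> \<notin> \<rat>"
    and per: "\<And>x h. f (x + of_int h) = f x"
    and loc: "\<And>x. \<forall>\<^sub>F y in at_right x. f y = f x"
    and bd: "\<And>n x. \<bar>cocycle f \<alpha> n x\<bar> \<le> K"
  obtains g :: "real \<Rightarrow> real" where
    "\<And>x h. g (x + of_int h) = g x"
    "\<And>n x. g (x + of_int n * \<alpha>) = g x - cocycle f \<alpha> n x"
    "\<And>x. (g \<longlongrightarrow> g x) (at_right x)"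
proof -
  define S where "S = cocycle f \<alpha>"
  define G where "G = (\<lambda>x. SUP n. S n x)"
  define H where "H = (\<lambda>x. INF n. S n x)"
  have bda: "bdd_above (range (\<lambda>n. S n x))" for x
    using bd[of _ x] by (intro bdd_aboveI[of _ K]) (auto simp: S_def abs_le_iff)
  have bdb: "bdd_below (range (\<lambda>n. S n x))" for x
  proof (intro bdd_belowI[of _ "- K"])
    fix y assume "y \<in> range (\<lambda>n. S n x)"
    thus "- K \<le> y" using bd[of _ x] by (auto simp: S_def abs_le_iff minus_le_iff)
  qed
  have G_ge: "S n x \<le> G x" for n x unfolding G_def by (intro cSUP_upper bda) auto
  have H_le: "H x \<le> S n x" for n x unfolding H_def by (intro cINF_lower bdb) auto
  have G_approx: "\<exists>n. G x - \<epsilon> < S n x" if "\<epsilon> > 0" for x \<epsilon>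
  proof -
    have "G x - \<epsilon> < (SUP n. S n x)" using that by (simp add: G_def)
    thus ?thesis by (subst (asm) less_cSUP_iff) (auto intro: bda)
  qed
  have H_approx: "\<exists>n. S n x < H x + \<epsilon>" if "\<epsilon> > 0" for x \<epsilon>
  proof -
    have "(INF n. S n x) < H x + \<epsilon>" using that by (simp add: H_def)
    thus ?thesis by (subst (asm) cINF_less_iff) (auto intro: bdb)
  qed
  have per_S: "S n (x + of_int h) = S n x" for n x h
    unfolding S_def by (rule cocycle_periodic) (rule per)
  have per_G: "G (x + of_int h) = G x" and per_H: "H (x + of_int h) = H x" for x h
    by (simp_all add: G_def H_def per_S)
  have S_shift: "S m (x + of_int n * \<alpha>) = S (n + m) x - S n x" for m n x
    using cocycle_add[of f \<alpha> n m x] by (simp add: S_def)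
  have G_shift: "G (x + of_int n * \<alpha>) = G x - S n x" for n x
  proof (rule antisym)
    show "G (x + of_int n * \<alpha>) \<le> G x - S n x"
      by (subst G_def, rule cSUP_least) (auto simp: S_shift G_ge)
    have "G x \<le> G (x + of_int n * \<alpha>) + S n x"
    proof (subst G_def, rule cSUP_least)
      fix m
      show "S m x \<le> G (x + of_int n * \<alpha>) + S n x"
        using G_ge[of "m - n" "x + of_int n * \<alpha>"] by (simp add: S_shift)
    qed auto
    thus "G x - S n x \<le> G (x + of_int n * \<alpha>)" by simp
  qed
  have H_shift: "H (x + of_int n * \<alpha>) = H x - S n x" for n x
  proof (rule antisym)
    show "H x - S n x \<le> H (x + of_int n * \<alpha>)"
      by (subst (2) H_def, rule cINF_greatest) (auto simp: S_shift H_le)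
    have "H (x + of_int n * \<alpha>) + S n x \<le> H x"
    proof (subst (2) H_def, rule cINF_greatest)
      fix m
      show "H (x + of_int n * \<alpha>) + S n x \<le> S m x"
        using H_le[of "x + of_int n * \<alpha>" "m - n"] by (simp add: S_shift)
    qed auto
    thus "H (x + of_int n * \<alpha>) \<le> H x - S n x" by simp
  qed
  have S_loc: "\<forall>\<^sub>F y in at_right x. S n y = S n x" for n x
    unfolding S_def by (rule eventually_cocycle_at_right) (rule loc)
  have osc_le: "G y - H y \<le> G x - H x" for x y
  proof (rule field_le_epsilon)
    fix \<epsilon> :: real assume "\<epsilon> > 0"
    obtain n where n: "G y - \<epsilon> / 2 < S n y" using G_approx[of "\<epsilon> / 2"] \<open>\<epsilon> > 0\<close> by auto
    obtain m where m: "S m y < H y + \<epsilon> / 2" using H_approx[of "\<epsilon> / 2"] \<open>\<epsilon> > 0\<close> by auto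
    have "\<forall>\<^sub>F z in at_right (y - x). S n (x + z) = S n y \<and> S m (x + z) = S m y"
      using eventually_conj[OF S_loc[of n y] S_loc[of m y]]
      by (simp add: eventually_at_right_to_0[of _ y] eventually_at_right_to_0[of _ "y - x"])
    then obtain N h where N: "S n (x + (real N * \<alpha> + of_int h)) = S n y"
        "S m (x + (real N * \<alpha> + of_int h)) = S m y"
      using orbit_approaches_from_right[OF irr, where M = 0] by blast
    have "G y - H y - \<epsilon> \<le> S n y - S m y" using n m by linarith
    also have "\<dots> = S n (x + of_int (int N) * \<alpha>) - S m (x + of_int (int N) * \<alpha>)"
      using N per_S[of _ "x + real N * \<alpha>" h] by (simp add: add.assoc)
    also have "\<dots> \<le> G (x + of_int (int N) * \<alpha>) - H (x + of_int (int N) * \<alpha>)"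
      by (intro diff_mono G_ge H_le)
    also have "\<dots> = G x - H x" by (simp only: G_shift H_shift)
    finally show "G y - H y \<le> G x - H x + \<epsilon>" by simp
  qed
  have osc: "G y = H y + (G 0 - H 0)" for y using osc_le[of y 0] osc_le[of 0 y] by linarith
  have "(G \<longlongrightarrow> G x) (at_right x)" for x
  proof (rule tendstoI)
    fix \<epsilon> :: real assume "\<epsilon> > 0"
    obtain n where n: "G x - \<epsilon> < S n x" using G_approx[OF \<open>\<epsilon> > 0\<close>] by auto
    obtain m where m: "S m x < H x + \<epsilon>" using H_approx[OF \<open>\<epsilon> > 0\<close>] by auto
    have "\<forall>\<^sub>F y in at_right x. S n y = S n x \<and> S m y = S m x"
      using S_loc by (intro eventually_conj)
    thus "\<forall>\<^sub>F y in at_right x. dist (G y) (G x) < \<epsilon>"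
    proof eventually_elim
      case (elim y)
      show ?case using elim n m G_ge[of n y] H_le[of y m] osc[of x] osc[of y]
        by (auto simp: dist_real_def abs_less_iff)
    qed
  qed
  with per_G G_shift show thesis by (intro that[of G]) (auto simp: S_def)
qed

section \<open>Kesten's theorem for a single arc\<close>

text \<open>Near \<open>0\<close> the function is smaller than \<open>1/4\<close>, so the integer defect of additivity vanishes there and
\<open>r\<close> is truly additive; right-continuity makes it linear on a short interval, and additivity modulo 1
spreads the slope to the whole line. The slope is an integer because \<open>r 1\<close> is.\<close>
lemma right_continuous_hom_mod_Ints:
  fixes r :: "real \<Rightarrow> real"
  assumes hom: "\<And>x y. r (x + y) - r x - r y \<in> \<int>"
    and cont: "(r \<longlongrightarrow> 0) (at_right 0)" and r0: "r 0 = 0" and r1: "r 1 \<in> \<int>"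
  obtains c :: int where "\<And>x. r x - of_int c * x \<in> \<int>"
proof -
  have "\<forall>\<^sub>F x in at_right 0. dist (r x) 0 < 1/4"
    using tendstoD[OF cont, of "1/4"] by simp
  then obtain \<delta> where \<delta>: "\<delta> > 0" "\<And>x. 0 < x \<Longrightarrow> x < \<delta> \<Longrightarrow> \<bar>r x\<bar> < 1/4"
    by (auto simp: eventually_at_right_field dist_real_def)
  have small: "\<bar>r x\<bar> < 1/4" if "0 \<le> x" "x < \<delta>" for x
    using \<delta>(2)[of x] that r0 by (cases "x = 0") auto
  have add: "r (x + y) = r x + r y" if "0 \<le> x" "0 \<le> y" "x + y < \<delta>" for x y
  proof -
    obtain k where k: "r (x + y) - r x - r y = of_int k" using hom[of x y] by (auto elim: Ints_cases)
    have "\<bar>of_int k :: real\<bar> < 1"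
      using small[of x] small[of y] small[of "x + y"] that unfolding k[symmetric] by linarith
    hence "k = 0" by linarith
    thus ?thesis using k by simp
  qed
  have mult: "r (real j * x) = real j * r x" if "0 \<le> x" "real j * x < \<delta>" for j x
    using that(2)
  proof (induction j)
    case (Suc j)
    have "real j * x < \<delta>" using Suc.prems that(1) by (simp add: algebra_simps)
    with Suc add[of "real j * x" x] that(1) show ?case by (simp add: algebra_simps)
  qed (simp add: r0)
  have mult_mod: "r (real j * x) - real j * r x \<in> \<int>" for j x
  proof (induction j)
    case (Suc j)
    have "r (real (Suc j) * x) - real (Suc j) * r x
        = (r (real j * x + x) - r (real j * x) - r x) + (r (real j * x) - real j * r x)"
      by (simp add: algebra_simps)
    thus ?case using hom[of "real j * x" x] Suc by (metis Ints_add)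
  qed (simp add: r0)
  obtain n where n: "n > 0" "1 / real n < \<delta>"
    using \<delta>(1) by (metis real_arch_inverse gr_zeroI inverse_eq_divide)
  have "real n * r (1 / real n) \<in> \<int>"
    using mult_mod[of n "1 / real n"] r1 n(1) Ints_diff by fastforce
  then obtain c where c: "real n * r (1 / real n) = of_int c" by (auto elim: Ints_cases)
  have lin: "r y = of_int c * y" if y: "0 \<le> y" "y \<le> 1 / real n" for y
  proof -
    have cont': "((\<lambda>h. r h - of_int c * h) \<longlongrightarrow> 0 - of_int c * 0) (at_right 0)"
      by (intro tendsto_intros cont)
    have "\<bar>r y - of_int c * y\<bar> \<le> \<epsilon>" if \<epsilon>: "\<epsilon> > 0" for \<epsilon>
    proof -
      obtain b where b: "b > 0" "\<And>h. 0 < h \<Longrightarrow> h < b \<Longrightarrow> \<bar>r h - of_int c * h\<bar> < \<epsilon>"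
        using tendstoD[OF cont' \<epsilon>] by (auto simp: eventually_at_right_field dist_real_def)
      obtain q where q: "q > 0" "1 / real q < b"
        using b(1) by (metis real_arch_inverse gr_zeroI inverse_eq_divide)
      \<comment> \<open>The grid of step \<open>u\<close> refines \<open>1/n\<close>, so \<open>r\<close> is exactly linear with slope \<open>c\<close> on it; the
        distance from \<open>y\<close> down to the grid is below \<open>b\<close>, where the deviation is small.\<close>
      define u where "u = 1 / (real n * real q)"
      have u: "u > 0" "u < b" "real q * u = 1 / real n" "real n * real q * u = 1"
      proof -
        show "u > 0" using n q by (simp add: u_def)
        have "u \<le> 1 / real q" unfolding u_def using n q by (simp add: field_simps)
        thus "u < b" using q by simp
      qed (use n q in \<open>simp_all add: u_def field_simps\<close>)
      define p where "p = nat \<lfloor>y / u\<rfloor>"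
      have p: "real p * u \<le> y" "y < real p * u + u"
      proof -
        have "real p = of_int \<lfloor>y / u\<rfloor>" using y u by (simp add: p_def)
        hence "real p \<le> y / u" "y / u < real p + 1" by linarith+
        thus "real p * u \<le> y" "y < real p * u + u" using u by (simp_all add: field_simps)
      qed
      have "real q * r u = r (1 / real n)" using mult[of u q] u n by simp
      hence ru: "r u = of_int c * u" using c u n q by (simp add: u_def field_simps)
      have "r y = r (real p * u) + r (y - real p * u)"
        using add[of "real p * u" "y - real p * u"] p y u n by simp
      also have "r (real p * u) = real p * r u" using mult[of u p] p y u n by simp
      finally have eq: "r y - of_int c * y = r (y - real p * u) - of_int c * (y - real p * u)"
        by (simp add: ru algebra_simps)
      show ?thesis
      proof (cases "y - real p * u = 0")
        case True
        thus ?thesis using eq r0 \<epsilon> by simp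
      next
        case False
        thus ?thesis using eq b(2)[of "y - real p * u"] p u by auto
      qed
    qed
    hence "\<bar>r y - of_int c * y\<bar> \<le> 0 + \<epsilon>" if "\<epsilon> > 0" for \<epsilon>
      using that by simp
    hence "\<bar>r y - of_int c * y\<bar> \<le> 0" by (rule field_le_epsilon)
    thus ?thesis by simp
  qed
  have pos: "r x - of_int c * x \<in> \<int>" if "x \<ge> 0" for x
  proof -
    define j where "j = Suc (nat \<lceil>real n * x\<rceil>)"
    have j: "j > 0" "real n * x \<le> real j" unfolding j_def by linarith+
    have "r (x / real j) = of_int c * (x / real j)"
      using j n that by (intro lin) (auto simp: field_simps)
    thus ?thesis using mult_mod[of j "x / real j"] j by simp
  qed
  have "r x - of_int c * x \<in> \<int>" for x
  proof (cases "x \<ge> 0")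
    case False
    have "r x - of_int c * x = - (r (x + - x) - r x - r (- x)) - (r (- x) - of_int c * (- x))"
      by (simp add: r0)
    thus ?thesis using hom[of x "- x"] pos[of "- x"] False
      by (metis Ints_diff Ints_minus linear neg_0_le_iff_le)
  qed (rule pos)
  thus thesis by (rule that)
qed

text \<open>The ergodic sums of \<open>arc_indicator s l - l\<close> are congruent to \<open>- N l\<close> modulo 1 whatever their
starting point, so for the primitive \<open>g\<close> the second difference \<open>\<psi>\<close> below is an integer along the
orbit of \<open>0\<close>, and right-continuity extends this to all points.\<close>
theorem kesten_arc_length:
  fixes \<alpha> s l :: real
  assumes irr: "\<alpha> \<notin> \<rat>" and l: "0 < l" "l < 1"
    and bd: "\<And>N. \<bar>(\<Sum>n=1..N. arc_indicator s l (real n * \<alpha>)) - real N * l\<bar> \<le> C"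
  obtains k m :: int where "l = of_int k * \<alpha> + of_int m"
proof -
  define f where "f = (\<lambda>x. arc_indicator s l x - l)"
  have per: "f (x + of_int h) = f x" for x h by (simp add: f_def arc_indicator_add_of_int)
  have loc: "\<forall>\<^sub>F y in at_right x. f y = f x" for x
    using eventually_arc_indicator_at_right[of s l x] by eventually_elim (simp add: f_def)
  have f_mod: "f x + l \<in> \<int>" for x by (simp add: f_def arc_indicator_def)
  have S_mod: "cocycle f \<alpha> (int N) x + real N * l \<in> \<int>" for N x
  proof (induction N)
    case (Suc N)
    have "cocycle f \<alpha> (int (Suc N)) x + real (Suc N) * l
        = (cocycle f \<alpha> (int N) x + real N * l) + (f (x + of_int (int N) * \<alpha>) + l)"
      using cocycle_step[of f \<alpha> "int N" x] by (simp add: algebra_simps)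
    thus ?case using Suc f_mod by (metis Ints_add)
  qed simp
  have "cocycle f \<alpha> (int N) \<alpha> = (\<Sum>n=1..N. arc_indicator s l (real n * \<alpha>)) - real N * l" for N
  proof (induction N)
    case (Suc N)
    thus ?case using cocycle_step[of f \<alpha> "int N" \<alpha>] by (simp add: f_def algebra_simps)
  qed simp
  hence "\<bar>cocycle f \<alpha> n x\<bar> \<le> 2 * C" for n x
    using bounded_cocycle_if_bounded_on_orbit[OF irr per loc, of \<alpha> C n x] bd by simp
  then obtain g where g: "\<And>x h. g (x + of_int h) = g x"
    "\<And>n x. g (x + of_int n * \<alpha>) = g x - cocycle f \<alpha> n x"
    "\<And>x. (g \<longlongrightarrow> g x) (at_right x)"
    using right_continuous_primitive[OF irr per loc] by blast
  define r where "r = (\<lambda>x. g x - g 0)"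
  have hom: "r (x + y) - r x - r y \<in> \<int>" for x y
  proof (rule Ints_if_approx_Ints)
    fix \<epsilon> :: real assume "\<epsilon> > 0"
    define \<psi> where "\<psi> = (\<lambda>z. g (z + y) - g z - g y + g 0)"
    have "((\<lambda>z. g (z + y)) \<longlongrightarrow> g (x + y)) (at_right x)"
      using g(3)[of "x + y"] by (subst (asm) filterlim_at_right_to_0, subst filterlim_at_right_to_0)
        (simp add: add_ac)
    hence "(\<psi> \<longlongrightarrow> \<psi> x) (at_right x)" unfolding \<psi>_def by (intro tendsto_intros g(3))
    from tendstoD[OF this \<open>\<epsilon> > 0\<close>] obtain N h where
      N: "dist (\<psi> (real N * \<alpha> + of_int h)) (\<psi> x) < \<epsilon>"
      using orbit_approaches_from_right[OF irr, where M = 0] by blast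
    have "g (real N * \<alpha> + of_int h + y) = g y - cocycle f \<alpha> (int N) y"
      using g(1)[of "y + of_int (int N) * \<alpha>" h] g(2)[of y "int N"] by (simp add: algebra_simps)
    moreover have "g (real N * \<alpha> + of_int h) = g 0 - cocycle f \<alpha> (int N) 0"
      using g(1)[of "of_int (int N) * \<alpha>" h] g(2)[of 0 "int N"] by simp
    ultimately have "\<psi> (real N * \<alpha> + of_int h)
        = (cocycle f \<alpha> (int N) 0 + real N * l) - (cocycle f \<alpha> (int N) y + real N * l)"
      by (simp add: \<psi>_def)
    hence "\<psi> (real N * \<alpha> + of_int h) \<in> \<int>" using S_mod by (metis Ints_diff)
    moreover have "\<psi> x = r (x + y) - r x - r y" by (simp add: \<psi>_def r_def)
    ultimately show "\<exists>k\<in>\<int>. \<bar>k - (r (x + y) - r x - r y)\<bar> < \<epsilon>"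
      using N by (auto simp: dist_real_def)
  qed
  have "(r \<longlongrightarrow> g 0 - g 0) (at_right 0)" unfolding r_def by (intro tendsto_intros g(3))
  moreover have "r 1 \<in> \<int>" using g(1)[of 0 1] by (simp add: r_def)
  ultimately obtain c where c: "\<And>x. r x - of_int c * x \<in> \<int>"
    using right_continuous_hom_mod_Ints[OF hom] by (auto simp: r_def)
  have "r \<alpha> = - f 0" using g(2)[of 0 1] cocycle_step[of f \<alpha> 0 0] by (simp add: r_def)
  hence "l - of_int c * \<alpha> = (r \<alpha> - of_int c * \<alpha>) + (f 0 + l)" by simp
  hence "l - of_int c * \<alpha> \<in> \<int>" using c f_mod by (metis Ints_add)
  then obtain m where "l - of_int c * \<alpha> = of_int m" by (auto elim: Ints_cases)
  thus thesis using that[of c m] by (simp add: algebra_simps)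
qed

section \<open>Telescoping for arc lengths in the orbit\<close>
lemma sum_shift_telescope:
  fixes \<phi> :: "int \<Rightarrow> real"
  shows "(\<Sum>n=1..N. \<phi> (int n - int q) - \<phi> (int n))
       = (\<Sum>i=1..q. \<phi> (1 - int i)) - (\<Sum>i=1..q. \<phi> (int N + 1 - int i))"
proof (induction N)
  case (Suc N)
  have "(\<Sum>i=1..q. \<phi> (int N + 1 - int i)) - (\<Sum>i=1..q. \<phi> (int (Suc N) + 1 - int i))
      = (\<Sum>i=1..q. \<phi> (int N + 1 - int i) - \<phi> (int N + 2 - int i))"
    by (simp add: sum_subtractf algebra_simps)
  also have "\<dots> = \<phi> (int (Suc N) - int q) - \<phi> (int (Suc N))"
    by (induction q) (simp_all add: algebra_simps)
  finally show ?case using Suc by simp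
qed simp

text \<open>Since \<open>frac (n \<alpha> - s - l) = frac ((n - k) \<alpha> - s)\<close>, the discrepancy telescopes to \<open>\<bar>k\<bar>\<close> boundary
terms at each end. The offset \<open>b\<close> merges the two signs: for \<open>k < 0\<close> the boundary terms lie
\<open>\<bar>k\<bar>\<close> steps later.\<close>
lemma discrepancy_eq_sum_frac:
  fixes \<alpha> s l :: real and k m :: int
  assumes l: "0 < l" "l < 1" and l_eq: "l = of_int k * \<alpha> + of_int m"
  defines "b \<equiv> (if k > 0 then 1 else 1 - k)"
  shows "(\<Sum>n=1..N. arc_indicator s l (real n * \<alpha>)) - real N * l
       = sgn (of_int k) * ((\<Sum>i=1..nat \<bar>k\<bar>. frac (of_int (b - int i) * \<alpha> - s))
            - (\<Sum>i=1..nat \<bar>k\<bar>. frac (real N * \<alpha> + of_int (b - int i) * \<alpha> - s)))"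
proof -
  define \<phi> where "\<phi> = (\<lambda>n::int. frac (of_int n * \<alpha> - s))"
  have "frac (real n * \<alpha> - s - l) = \<phi> (int n - k)" for n
    using frac_add_of_int[of "of_int (int n - k) * \<alpha> - s" "- m"]
    by (simp add: \<phi>_def l_eq algebra_simps)
  hence "(\<Sum>n=1..N. arc_indicator s l (real n * \<alpha>)) - real N * l
       = (\<Sum>n=1..N. \<phi> (int n - k) - \<phi> (int n))"
    by (simp add: arc_indicator_eq[OF l] sum_subtractf sum.distrib \<phi>_def)
  also have "\<dots> = sgn (of_int k) * ((\<Sum>i=1..nat \<bar>k\<bar>. \<phi> (b - int i))
            - (\<Sum>i=1..nat \<bar>k\<bar>. \<phi> (int N + (b - int i))))"
  proof (cases k "0 :: int" rule: linorder_cases)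
    case less
    have "(\<Sum>n=1..N. \<phi> (int n - k) - \<phi> (int n))
        = - (\<Sum>n=1..N. \<phi> (int n - int (nat \<bar>k\<bar>) - k) - \<phi> (int n - k))"
      using less by (simp add: sum_negf[symmetric])
    also have "\<dots> = - ((\<Sum>i=1..nat \<bar>k\<bar>. \<phi> (1 - int i - k))
            - (\<Sum>i=1..nat \<bar>k\<bar>. \<phi> (int N + 1 - int i - k)))"
      by (subst sum_shift_telescope[of "\<lambda>n. \<phi> (n - k)"]) simp
    finally show ?thesis using less by (simp add: b_def algebra_simps)
  next
    case greater
    thus ?thesis using sum_shift_telescope[of \<phi> "nat \<bar>k\<bar>" N] by (simp add: b_def algebra_simps)
  qed simp
  finally show ?thesis by (simp add: \<phi>_def algebra_simps)
qed

lemma discrepancy_bounded: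
  fixes \<alpha> s l :: real and k m :: int
  assumes "0 < l" "l < 1" and "l = of_int k * \<alpha> + of_int m"
  shows "\<bar>(\<Sum>n=1..N. arc_indicator s l (real n * \<alpha>)) - real N * l\<bar> \<le> \<bar>of_int k\<bar>"
proof -
  define b where "b = (if k > 0 then 1 else 1 - k)"
  have bound: "0 \<le> (\<Sum>i=1..nat \<bar>k\<bar>. frac (g i)) \<and> (\<Sum>i=1..nat \<bar>k\<bar>. frac (g i)) \<le> of_int \<bar>k\<bar>"
    for g :: "nat \<Rightarrow> real"
    using sum_bounded_above[of "{1..nat \<bar>k\<bar>}" "\<lambda>i. frac (g i)" 1] frac_lt_1
    by (auto intro: sum_nonneg less_imp_le)
  have scaled: "\<bar>sgn (of_int k) * (x - y)\<bar> \<le> \<bar>of_int k :: real\<bar>"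
    if "0 \<le> x \<and> x \<le> of_int \<bar>k\<bar>" "0 \<le> y \<and> y \<le> of_int \<bar>k\<bar>" for x y :: real
    using that by (auto simp: sgn_if abs_le_iff)
  thus ?thesis unfolding discrepancy_eq_sum_frac[OF assms] by (intro scaled bound)
qed

section \<open>Equidistribution\<close>
lemma LIMSEQ_squeeze:
  fixes X :: "nat \<Rightarrow> real"
  assumes lower: "\<And>\<epsilon>. \<epsilon> > 0 \<Longrightarrow> \<exists>A a. A \<longlonglongrightarrow> a \<and> l - \<epsilon> < a \<and> (\<forall>N. A N \<le> X N)"
    and upper: "\<And>\<epsilon>. \<epsilon> > 0 \<Longrightarrow> \<exists>B b. B \<longlonglongrightarrow> b \<and> b < l + \<epsilon> \<and> (\<forall>N. X N \<le> B N)"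
  shows "X \<longlonglongrightarrow> l"
proof (rule order_tendstoI)
  fix y assume "y < l"
  then obtain A a where A: "A \<longlonglongrightarrow> a" "y < a" "\<forall>N. A N \<le> X N"
    using lower[of "l - y"] by auto
  show "\<forall>\<^sub>F N in sequentially. y < X N"
    using order_tendstoD(1)[OF A(1,2)] by eventually_elim (use A(3) in \<open>auto intro: less_le_trans\<close>)
next
  fix y assume "l < y"
  then obtain B b where B: "B \<longlonglongrightarrow> b" "b < y" "\<forall>N. X N \<le> B N"
    using upper[of "y - l"] by auto
  show "\<forall>\<^sub>F N in sequentially. X N < y"
    using order_tendstoD(2)[OF B(1,2)] by eventually_elim (use B(3) in \<open>auto intro: le_less_trans\<close>)
qed

definition freq :: "(nat \<Rightarrow> bool) \<Rightarrow> nat \<Rightarrow> real" where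
  "freq P N = real (card {n \<in> {1..N}. P n}) / real N"

lemma freq_mono:
  assumes "\<And>n. n \<ge> 1 \<Longrightarrow> P n \<Longrightarrow> Q n"
  shows "freq P N \<le> freq Q N"
  unfolding freq_def using assms by (intro divide_right_mono of_nat_mono card_mono) auto

lemma freq_nonneg: "0 \<le> freq P N"
  by (simp add: freq_def)

lemma freq_le_1: "freq P N \<le> 1"
proof -
  have "card {n \<in> {1..N}. P n} \<le> card {1..N}" by (intro card_mono) auto
  thus ?thesis by (auto simp: freq_def divide_le_eq_1)
qed

lemma sum_arc_indicator_eq_card:
  "(\<Sum>n=1..N. arc_indicator s l (real n * \<alpha>)) = real (card {n \<in> {1..N}. frac (real n * \<alpha> - s) < l})"
  by (simp add: arc_indicator_def sum.If_cases Int_def)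

lemma freq_arc_bounded_discrepancy:
  fixes \<alpha> s l :: real and k m :: int
  assumes "0 < l" "l < 1" "l = of_int k * \<alpha> + of_int m"
  shows "freq (\<lambda>n. frac (real n * \<alpha> - s) < l) \<longlonglongrightarrow> l"
proof (rule LIM_zero_cancel, rule Lim_null_comparison)
  show "(\<lambda>N. \<bar>of_int k\<bar> / real N) \<longlonglongrightarrow> 0" by (rule lim_const_over_n)
  show "\<forall>\<^sub>F N in sequentially. norm (freq (\<lambda>n. frac (real n * \<alpha> - s) < l) N - l) \<le> \<bar>of_int k\<bar> / real N"
    using eventually_gt_at_top[of 0]
  proof eventually_elim
    case (elim N)
    have "freq (\<lambda>n. frac (real n * \<alpha> - s) < l) N - l
        = ((\<Sum>n=1..N. arc_indicator s l (real n * \<alpha>)) - real N * l) / real N"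
      unfolding freq_def sum_arc_indicator_eq_card using elim by (simp add: field_simps)
    thus ?case using divide_right_mono[OF discrepancy_bounded[OF assms, where N = N and s = s], of "real N"] elim
      by (simp add: abs_divide)
  qed
qed

lemma orbit_point_between:
  fixes \<alpha> u v :: real
  assumes "\<alpha> \<notin> \<rat>" "u < v"
  obtains k m :: int where "u < of_int k * \<alpha> + of_int m" "of_int k * \<alpha> + of_int m < v"
proof -
  obtain h k where "\<bar>of_int k * \<alpha> - of_int h - (u + v) / 2\<bar> < (v - u) / 2"
    using sequence_of_fractional_parts_is_dense[OF assms(1), of "(v - u) / 2"] assms(2)
    by (metis diff_gt_0_iff_gt half_gt_zero)
  thus thesis using that[of k "- h"] by (simp add: abs_less_iff field_simps)
qed

text \<open>Weyl's equidistribution theorem for arcs: the lengths \<open>k \<alpha> + m\<close>, for which bounded discrepancy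
already gives the frequency, are dense, and the frequency is monotone in the length.\<close>
lemma freq_arc:
  fixes \<alpha> s l :: real
  assumes irr: "\<alpha> \<notin> \<rat>" and l: "0 \<le> l" "l \<le> 1"
  shows "freq (\<lambda>n. frac (real n * \<alpha> - s) < l) \<longlonglongrightarrow> l"
proof (rule LIMSEQ_squeeze)
  fix \<epsilon> :: real assume \<epsilon>: "\<epsilon> > 0"
  show "\<exists>A a. A \<longlonglongrightarrow> a \<and> l - \<epsilon> < a \<and> (\<forall>N. A N \<le> freq (\<lambda>n. frac (real n * \<alpha> - s) < l) N)"
  proof (cases "l = 0")
    case True
    thus ?thesis using \<epsilon> freq_nonneg by (intro exI[of _ "\<lambda>_. 0"] exI[of _ 0]) auto
  next
    case False
    then obtain k m where "max 0 (l - \<epsilon>) < of_int k * \<alpha> + of_int m" "of_int k * \<alpha> + of_int m < l"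
      using orbit_point_between[OF irr, of "max 0 (l - \<epsilon>)" l] l \<epsilon> by auto
    thus ?thesis using l
      freq_arc_bounded_discrepancy[of "of_int k * \<alpha> + of_int m" k \<alpha> m s, OF _ _ refl]
      by (intro exI[of _ "freq (\<lambda>n. frac (real n * \<alpha> - s) < of_int k * \<alpha> + of_int m)"]
          exI[of _ "of_int k * \<alpha> + of_int m"] conjI allI freq_mono) auto
  qed
  show "\<exists>A a. A \<longlonglongrightarrow> a \<and> a < l + \<epsilon> \<and> (\<forall>N. freq (\<lambda>n. frac (real n * \<alpha> - s) < l) N \<le> A N)"
  proof (cases "l = 1")
    case True
    thus ?thesis using \<epsilon> freq_le_1 by (intro exI[of _ "\<lambda>_. 1"] exI[of _ 1]) auto
  next
    case False
    then obtain k m where "l < of_int k * \<alpha> + of_int m" "of_int k * \<alpha> + of_int m < min 1 (l + \<epsilon>)"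
      using orbit_point_between[OF irr, of l "min 1 (l + \<epsilon>)"] l \<epsilon> by auto
    thus ?thesis using l
      freq_arc_bounded_discrepancy[of "of_int k * \<alpha> + of_int m" k \<alpha> m s, OF _ _ refl]
      by (intro exI[of _ "freq (\<lambda>n. frac (real n * \<alpha> - s) < of_int k * \<alpha> + of_int m)"]
          exI[of _ "of_int k * \<alpha> + of_int m"] conjI allI freq_mono) auto
  qed
qed

text \<open>An interval inside \<open>[0, 1)\<close> becomes an arc starting at \<open>0\<close> after moving its left end there.\<close>
lemma frac_between_iff:
  fixes y :: real
  assumes "0 \<le> lo" "lo \<le> hi" "hi \<le> 1"
  shows "lo \<le> frac y \<and> frac y < hi \<longleftrightarrow> frac (y - lo) < hi - lo"
proof (cases "lo \<le> frac y")
  case True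
  hence "frac (y - lo) = frac y - lo"
    unfolding frac_unique_iff
  proof (intro conjI)
    show "y - lo - (frac y - lo) \<in> \<int>" by (simp add: frac_def)
  qed (use True assms frac_lt_1[of y] in linarith)+
  thus ?thesis using True by auto
next
  case False
  hence "frac (y - lo) = frac y + 1 - lo"
    unfolding frac_unique_iff
  proof (intro conjI)
    have "y - lo - (frac y + 1 - lo) = of_int (\<lfloor>y\<rfloor> - 1)" by (simp add: frac_def)
    thus "y - lo - (frac y + 1 - lo) \<in> \<int>" by (metis Ints_of_int)
  qed (use False assms frac_ge_0[of y] in linarith)+
  thus ?thesis using False assms frac_ge_0[of y] by (smt (verit))
qed

text \<open>Whether the endpoints belong to the interval does not affect the limit. Leaving this open in the
hypotheses lets one statement serve increasing and decreasing linear pieces, whose preimages of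
half-open intervals are open on different sides.\<close>
lemma freq_interval:
  fixes \<alpha> \<theta> lo hi :: real
  assumes irr: "\<alpha> \<notin> \<rat>" and lh: "0 \<le> lo" "hi \<le> 1"
    and inner: "\<And>n. n \<ge> 1 \<Longrightarrow> lo < frac (real n * \<alpha> - \<theta>) \<Longrightarrow> frac (real n * \<alpha> - \<theta>) < hi \<Longrightarrow> P n"
    and outer: "\<And>n. n \<ge> 1 \<Longrightarrow> P n \<Longrightarrow> lo \<le> frac (real n * \<alpha> - \<theta>) \<and> frac (real n * \<alpha> - \<theta>) \<le> hi"
  shows "freq P \<longlonglongrightarrow> max 0 (hi - lo)"
proof (cases "hi < lo")
  case True
  hence "{n \<in> {1..N}. P n} = {}" for N using outer by force
  hence "freq P = (\<lambda>_. 0)" unfolding freq_def fun_eq_iff by (metis card.empty div_0 of_nat_0)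
  thus ?thesis using True by simp
next
  case False
  have half_open: "freq (\<lambda>n. a \<le> frac (real n * \<alpha> - \<theta>) \<and> frac (real n * \<alpha> - \<theta>) < c) \<longlonglongrightarrow> c - a"
    if "0 \<le> a" "a \<le> c" "c \<le> 1" for a c
    unfolding frac_between_iff[OF that]
    using freq_arc[OF irr, of "c - a" "\<theta> + a"] that by (simp add: algebra_simps)
  have "freq P \<longlonglongrightarrow> hi - lo"
  proof (rule LIMSEQ_squeeze)
    fix \<epsilon> :: real assume \<epsilon>: "\<epsilon> > 0"
    define a where "a = min (lo + \<epsilon> / 2) hi"
    have "freq (\<lambda>n. a \<le> frac (real n * \<alpha> - \<theta>) \<and> frac (real n * \<alpha> - \<theta>) < hi) \<longlonglongrightarrow> hi - a"
      using False lh \<epsilon> by (intro half_open) (auto simp: a_def)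
    moreover have "hi - lo - \<epsilon> < hi - a" using \<epsilon> by (auto simp: a_def)
    moreover have "freq (\<lambda>n. a \<le> frac (real n * \<alpha> - \<theta>) \<and> frac (real n * \<alpha> - \<theta>) < hi) N \<le> freq P N" for N
      by (intro freq_mono inner) (use \<epsilon> in \<open>auto simp: a_def min_def split: if_splits\<close>)
    ultimately show "\<exists>A a. A \<longlonglongrightarrow> a \<and> hi - lo - \<epsilon> < a \<and> (\<forall>N. A N \<le> freq P N)" by blast
    define c where "c = min (hi + \<epsilon> / 2) 1"
    have "freq (\<lambda>n. lo \<le> frac (real n * \<alpha> - \<theta>) \<and> frac (real n * \<alpha> - \<theta>) < c) \<longlonglongrightarrow> c - lo"
      using False lh \<epsilon> by (intro half_open) (auto simp: c_def)
    moreover have "c - lo < hi - lo + \<epsilon>" using \<epsilon> by (auto simp: c_def)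
    moreover have "freq P N \<le> freq (\<lambda>n. lo \<le> frac (real n * \<alpha> - \<theta>) \<and> frac (real n * \<alpha> - \<theta>) < c) N" for N
    proof (rule freq_mono)
      fix n :: nat assume "n \<ge> 1" "P n"
      thus "lo \<le> frac (real n * \<alpha> - \<theta>) \<and> frac (real n * \<alpha> - \<theta>) < c"
        using outer[of n] \<epsilon> frac_lt_1[of "real n * \<alpha> - \<theta>"] by (auto simp: c_def)
    qed
    ultimately show "\<exists>B b. B \<longlonglongrightarrow> b \<and> b < hi - lo + \<epsilon> \<and> (\<forall>N. freq P N \<le> B N)" by blast
  qed
  thus ?thesis using False by simp
qed

section \<open>Limit densities of piecewise linear functions of the orbit\<close>
lemma has_bochner_integral_Icc:
  "has_bochner_integral lborel (indicator {a..b} :: real \<Rightarrow> real) (max 0 (b - a))"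
proof -
  have "measure lborel {a..b} = max 0 (b - a)" by (cases "a \<le> b") auto
  thus ?thesis using has_bochner_integral_real_indicator[of "{a..b}" lborel]
    by (cases "a \<le> b") (auto simp: emeasure_lborel_Icc_eq)
qed

lemma has_bochner_integral_uniform_density:
  assumes "l < u"
  shows "has_bochner_integral lborel (uniform_density l u) 1"
  using has_bochner_integral_mult_left[OF has_bochner_integral_Icc[of l u], of "1 / (u - l)"] assms
  by (simp add: uniform_density_def[abs_def] divide_inverse)

lemma has_bochner_integral_uniform_density_Icc:
  "has_bochner_integral lborel (\<lambda>x. indicator {s..t} x *\<^sub>R uniform_density l u x)
     (max 0 (min u t - max l s) / (u - l))"
proof -
  have "(\<lambda>x. indicator {s..t} x *\<^sub>R uniform_density l u x)
      = (\<lambda>x. indicator {max l s..min u t} x * (1 / (u - l)))"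
    by (auto simp: uniform_density_def indicator_def fun_eq_iff)
  thus ?thesis
    using has_bochner_integral_mult_left[OF has_bochner_integral_Icc[of "max l s" "min u t"], of "1 / (u - l)"]
    by simp
qed

lemma freq_partition:
  assumes "finite I" "\<And>n. n \<ge> 1 \<Longrightarrow> \<exists>!i. i \<in> I \<and> R i n"
  shows "freq Q N = (\<Sum>i\<in>I. freq (\<lambda>n. R i n \<and> Q n) N)"
proof -
  have "{n \<in> {1..N}. Q n} = (\<Union>i\<in>I. {n \<in> {1..N}. R i n \<and> Q n})"
  proof (intro equalityI subsetI)
    fix n assume n: "n \<in> {n \<in> {1..N}. Q n}"
    then obtain i where "i \<in> I" "R i n" using assms(2)[of n] by auto
    with n show "n \<in> (\<Union>i\<in>I. {n \<in> {1..N}. R i n \<and> Q n})" by auto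
  qed auto
  moreover have "card (\<Union>i\<in>I. {n \<in> {1..N}. R i n \<and> Q n}) = (\<Sum>i\<in>I. card {n \<in> {1..N}. R i n \<and> Q n})"
  proof (rule card_UN_disjoint)
    show "\<forall>i\<in>I. \<forall>j\<in>I. i \<noteq> j \<longrightarrow> {n \<in> {1..N}. R i n \<and> Q n} \<inter> {n \<in> {1..N}. R j n \<and> Q n} = {}"
    proof (intro ballI impI equals0I)
      fix i j n assume "i \<in> I" "j \<in> I" "i \<noteq> j"
        "n \<in> {n \<in> {1..N}. R i n \<and> Q n} \<inter> {n \<in> {1..N}. R j n \<and> Q n}"
      thus False using assms(2)[of n] by auto
    qed
  qed (use assms(1) in auto)
  ultimately show ?thesis by (simp add: freq_def sum_divide_distrib)
qed

text \<open>On the arc of length \<open>w i\<close> starting at \<open>\<theta> i\<close> the function \<open>E\<close> runs linearly through an interval of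
length \<open>\<bar>\<kappa>\<bar> w i\<close>; equidistribution turns this into \<open>w i\<close> times a uniform distribution. That the
weights add up to 1 comes from counting all \<open>n\<close>, each of which lies in one arc.\<close>
lemma limit_density_piecewise_linear:
  fixes \<alpha> \<kappa> :: real and w e \<theta> :: "nat \<Rightarrow> real" and E :: "nat \<Rightarrow> real"
  assumes irr: "\<alpha> \<notin> \<rat>" and \<kappa>: "\<kappa> \<noteq> 0"
    and w: "\<And>i. i \<in> {1..q} \<Longrightarrow> 0 < w i \<and> w i \<le> 1"
    and part: "\<And>n. n \<ge> 1 \<Longrightarrow> \<exists>!i. i \<in> {1..q} \<and> frac (real n * \<alpha> - \<theta> i) < w i"
    and E: "\<And>n i. n \<ge> 1 \<Longrightarrow> i \<in> {1..q} \<Longrightarrow> frac (real n * \<alpha> - \<theta> i) < w i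
              \<Longrightarrow> E n = e i + \<kappa> * frac (real n * \<alpha> - \<theta> i)"
  shows "(\<Sum>i=1..q. w i) = 1"
    and "has_limit_density E (\<lambda>x. \<Sum>i=1..q. w i *
            uniform_density (e i + min 0 (\<kappa> * w i)) (e i + max 0 (\<kappa> * w i)) x)"
proof -
  define l where "l = (\<lambda>i. e i + min 0 (\<kappa> * w i))"
  define u where "u = (\<lambda>i. e i + max 0 (\<kappa> * w i))"
  have lu: "u i - l i = \<bar>\<kappa>\<bar> * w i" "l i < u i" if "i \<in> {1..q}" for i
  proof -
    have "\<kappa> * w i \<noteq> 0" "\<bar>\<kappa>\<bar> * w i = \<bar>\<kappa> * w i\<bar>"
      using w[OF that] \<kappa> by (auto simp: abs_mult)
    thus "u i - l i = \<bar>\<kappa>\<bar> * w i" "l i < u i" unfolding l_def u_def by linarith+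
  qed
  have "freq (\<lambda>_. True) \<longlonglongrightarrow> (\<Sum>i=1..q. w i)"
  proof -
    have "(\<lambda>N. \<Sum>i=1..q. freq (\<lambda>n. frac (real n * \<alpha> - \<theta> i) < w i \<and> True) N) \<longlonglongrightarrow> (\<Sum>i=1..q. w i)"
    proof (intro tendsto_sum)
      fix i assume "i \<in> {1..q}"
      from w[OF this] show "freq (\<lambda>n. frac (real n * \<alpha> - \<theta> i) < w i \<and> True) \<longlonglongrightarrow> w i"
        using freq_arc[OF irr, of "w i" "\<theta> i"] by simp
    qed
    thus ?thesis by (simp only: freq_partition[of "{1..q}" "\<lambda>i n. frac (real n * \<alpha> - \<theta> i) < w i", OF finite_atLeastAtMost part, symmetric])
  qed
  moreover have "freq (\<lambda>_. True) \<longlonglongrightarrow> 1"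
  proof (rule tendsto_eventually, use eventually_gt_at_top[of 0] in eventually_elim)
    case (elim N)
    have "{n \<in> {1..N}. True} = {1..N}" by auto
    thus ?case unfolding freq_def using elim by (simp only: card_atLeastAtMost) simp
  qed
  ultimately show sum_w: "(\<Sum>i=1..q. w i) = 1" using LIMSEQ_unique by blast
  define f where "f = (\<lambda>x. \<Sum>i=1..q. w i * uniform_density (l i) (u i) x)"
  have "has_bochner_integral lborel f (\<Sum>i=1..q. w i * 1)"
    unfolding f_def using lu
    by (intro has_bochner_integral_sum has_bochner_integral_mult_right has_bochner_integral_uniform_density) auto
  moreover have "0 \<le> f x" for x
    unfolding f_def uniform_density_def using w lu
    by (intro sum_nonneg mult_nonneg_nonneg divide_nonneg_nonneg) (auto simp: less_imp_le)
  ultimately have dens: "prob_density f" using sum_w by (simp add: prob_density_def)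
  have lim: "freq (\<lambda>n. s \<le> E n \<and> E n < t) \<longlonglongrightarrow> (LINT x:{s..t}|lborel. f x)" for s t
  proof -
    have one: "freq (\<lambda>n. frac (real n * \<alpha> - \<theta> i) < w i \<and> (s \<le> E n \<and> E n < t))
        \<longlonglongrightarrow> w i * (max 0 (min (u i) t - max (l i) s) / (u i - l i))" if i: "i \<in> {1..q}" for i
    proof -
      \<comment> \<open>The values in \<open>[s, t)\<close> correspond to the parameters between \<open>p\<close> and \<open>r\<close>.\<close>
      define p where "p = (if \<kappa> > 0 then (s - e i) / \<kappa> else (t - e i) / \<kappa>)"
      define r where "r = (if \<kappa> > 0 then (t - e i) / \<kappa> else (s - e i) / \<kappa>)"
      have "freq (\<lambda>n. frac (real n * \<alpha> - \<theta> i) < w i \<and> (s \<le> E n \<and> E n < t))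
          \<longlonglongrightarrow> max 0 (min (w i) r - max 0 p)"
      proof (rule freq_interval[OF irr])
        show "min (w i) r \<le> 1" using w[OF i] by auto
      next
        fix n :: nat assume n: "n \<ge> 1"
        show "frac (real n * \<alpha> - \<theta> i) < w i \<and> (s \<le> E n \<and> E n < t)"
          if "max 0 p < frac (real n * \<alpha> - \<theta> i)" "frac (real n * \<alpha> - \<theta> i) < min (w i) r"
          using that E[OF n i] \<kappa> by (cases "\<kappa> > 0") (auto simp: p_def r_def field_simps)
        show "max 0 p \<le> frac (real n * \<alpha> - \<theta> i) \<and> frac (real n * \<alpha> - \<theta> i) \<le> min (w i) r"
          if "frac (real n * \<alpha> - \<theta> i) < w i \<and> (s \<le> E n \<and> E n < t)"
          using that E[OF n i] \<kappa> by (cases "\<kappa> > 0") (auto simp: p_def r_def field_simps)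
      qed auto
      moreover have "w i * (max 0 (min (u i) t - max (l i) s) / (u i - l i)) = max 0 (min (w i) r - max 0 p)"
      proof -
        have "\<bar>\<kappa>\<bar> * max 0 (min (w i) r - max 0 p) = max 0 (min (u i) t - max (l i) s)"
        proof (cases "\<kappa> > 0")
          case True
          have [simp]: "\<kappa> * p = s - e i" "\<kappa> * r = t - e i" using True by (simp_all add: p_def r_def)
          have "\<bar>\<kappa>\<bar> * max 0 (min (w i) r - max 0 p) = max 0 (min (\<kappa> * w i) (t - e i) - max 0 (s - e i))"
            using True by (simp add: max_mult_distrib_left min_mult_distrib_left right_diff_distrib)
          moreover have "\<kappa> * w i > 0" using True w[OF i] by simp
          ultimately show ?thesis by (auto simp: l_def u_def min_def max_def)
        next
          case False
          hence "\<kappa> < 0" using \<kappa> by simp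
          have [simp]: "\<kappa> * p = t - e i" "\<kappa> * r = s - e i" using \<open>\<kappa> < 0\<close> by (simp_all add: p_def r_def)
          have "\<bar>\<kappa>\<bar> * max 0 (min (w i) r - max 0 p) = max 0 (min (- (\<kappa> * w i)) (e i - s) - max 0 (e i - t))"
            using \<open>\<kappa> < 0\<close> by (simp add: max_mult_distrib_left min_mult_distrib_left right_diff_distrib
                minus_max_eq_min minus_min_eq_max)
          moreover have "\<kappa> * w i < 0" using \<open>\<kappa> < 0\<close> w[OF i] by (simp add: mult_neg_pos)
          ultimately show ?thesis by (auto simp: l_def u_def min_def max_def)
        qed
        thus ?thesis using lu[OF i] w[OF i] \<kappa> by (simp add: field_simps)
      qed
      ultimately show ?thesis by simp
    qed
    have "has_bochner_integral lborel (\<lambda>x. \<Sum>i=1..q. w i * (indicator {s..t} x *\<^sub>R uniform_density (l i) (u i) x))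
        (\<Sum>i=1..q. w i * (max 0 (min (u i) t - max (l i) s) / (u i - l i)))"
      by (intro has_bochner_integral_sum has_bochner_integral_mult_right has_bochner_integral_uniform_density_Icc)
    moreover have "(\<lambda>x. \<Sum>i=1..q. w i * (indicator {s..t} x *\<^sub>R uniform_density (l i) (u i) x))
        = (\<lambda>x. indicator {s..t} x *\<^sub>R f x)"
      by (simp add: f_def sum_distrib_left mult_ac)
    ultimately have "(LINT x:{s..t}|lborel. f x)
        = (\<Sum>i=1..q. w i * (max 0 (min (u i) t - max (l i) s) / (u i - l i)))"
      unfolding set_lebesgue_integral_def by (simp add: has_bochner_integral_integral_eq)
    moreover have "(\<lambda>N. \<Sum>i=1..q. freq (\<lambda>n. frac (real n * \<alpha> - \<theta> i) < w i \<and> (s \<le> E n \<and> E n < t)) N)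
        \<longlonglongrightarrow> (\<Sum>i=1..q. w i * (max 0 (min (u i) t - max (l i) s) / (u i - l i)))"
      by (intro tendsto_sum one)
    ultimately show ?thesis
      by (simp only: freq_partition[of "{1..q}" "\<lambda>i n. frac (real n * \<alpha> - \<theta> i) < w i", OF finite_atLeastAtMost part, symmetric])
  qed
  have "has_limit_density E f" unfolding has_limit_density_def using dens lim by (simp add: freq_def[abs_def])
  thus "has_limit_density E (\<lambda>x. \<Sum>i=1..q. w i *
            uniform_density (e i + min 0 (\<kappa> * w i)) (e i + max 0 (\<kappa> * w i)) x)"
    by (simp add: f_def l_def u_def)
qed

text \<open>The distance from \<open>\<theta> i\<close> to the next of the other breakpoints in positive direction around the circle.
Indexing arcs by their left ends in this way avoids sorting the breakpoints; the inserted \<open>1\<close> is the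
whole circle, the right value for a single breakpoint.\<close>
definition arc_length :: "(nat \<Rightarrow> real) \<Rightarrow> nat set \<Rightarrow> nat \<Rightarrow> real" where
  "arc_length \<theta> I i = Min (insert 1 ((\<lambda>j. frac (\<theta> j - \<theta> i)) ` (I - {i})))"

lemma less_arc_length_iff:
  assumes "finite I"
  shows "x < arc_length \<theta> I i \<longleftrightarrow> x < 1 \<and> (\<forall>j\<in>I - {i}. x < frac (\<theta> j - \<theta> i))"
  unfolding arc_length_def using assms by (subst Min_gr_iff) auto

lemma arc_length_bounds:
  assumes "finite I" "i \<in> I" "\<And>i j. i \<in> I \<Longrightarrow> j \<in> I \<Longrightarrow> i \<noteq> j \<Longrightarrow> \<theta> i - \<theta> j \<notin> \<int>"
  shows "0 < arc_length \<theta> I i" "arc_length \<theta> I i \<le> 1"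
proof -
  show "0 < arc_length \<theta> I i" unfolding less_arc_length_iff[OF assms(1)] using assms by auto
  show "arc_length \<theta> I i \<le> 1" unfolding arc_length_def using assms(1) by (intro Min_le) auto
qed

text \<open>The arc containing \<open>x\<close> is the one whose left end is nearest to \<open>x\<close> from below, that is, the one
minimising \<open>frac (x - \<theta> i)\<close>; the minimum is attained once as the breakpoints are distinct modulo 1.\<close>
lemma ex1_arc:
  fixes x :: real
  assumes I: "finite I" "I \<noteq> {}" and dist: "\<And>i j. i \<in> I \<Longrightarrow> j \<in> I \<Longrightarrow> i \<noteq> j \<Longrightarrow> \<theta> i - \<theta> j \<notin> \<int>"
  shows "\<exists>!i. i \<in> I \<and> frac (x - \<theta> i) < arc_length \<theta> I i"
proof -
  define v where "v = (\<lambda>i. frac (x - \<theta> i))"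
  have fr: "frac (\<theta> j - \<theta> i) = (if v j \<le> v i then v i - v j else v i + 1 - v j)" for i j
    using frac_diff_pos[of "x - \<theta> j" "x - \<theta> i"] frac_diff_neg[of "x - \<theta> i" "x - \<theta> j"]
    by (auto simp: v_def)
  have neq: "v i \<noteq> v j" if "i \<in> I" "j \<in> I" "i \<noteq> j" for i j
    using fr[of i j] dist[OF that] by (auto simp: frac_eq_0_iff[symmetric] simp del: frac_eq_0_iff)
  have in_arc: "v i < arc_length \<theta> I i \<longleftrightarrow> (\<forall>j\<in>I - {i}. v i < v j)" if "i \<in> I" for i
  proof -
    have bnd: "0 \<le> v j" "v j < 1" for j by (simp_all add: v_def frac_lt_1)
    have "v i < frac (\<theta> j - \<theta> i) \<longleftrightarrow> v i < v j" if "j \<in> I - {i}" for j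
      using fr[of j i] neq[of i j] that \<open>i \<in> I\<close> bnd[of i] bnd[of j] by (auto split: if_splits)
    thus ?thesis unfolding less_arc_length_iff[OF I(1)] using bnd by auto
  qed
  obtain i where i: "i \<in> I" "\<And>j. j \<in> I \<Longrightarrow> v i \<le> v j"
    using ex_min_if_finite[of "v ` I"] I by (auto simp: not_less)
  show ?thesis
  proof (rule ex1I[of _ i])
    have "\<forall>j\<in>I - {i}. v i < v j"
    proof
      fix j assume "j \<in> I - {i}"
      thus "v i < v j" using i(2)[of j] neq[OF i(1), of j] by (auto simp: less_le)
    qed
    thus "i \<in> I \<and> frac (x - \<theta> i) < arc_length \<theta> I i"
      using in_arc[OF i(1)] i(1) by (simp add: v_def)
    fix j assume "j \<in> I \<and> frac (x - \<theta> j) < arc_length \<theta> I j"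
    hence j: "j \<in> I" "\<forall>i'\<in>I - {j}. v j < v i'" using in_arc[of j] unfolding v_def by blast+
    show "j = i"
    proof (rule ccontr)
      assume "j \<noteq> i"
      hence "v j < v i" using j(2) i(1) by blast
      with i(2)[OF j(1)] show False by simp
    qed
  qed
qed

text \<open>No sawtooth jumps inside an arc, so all of them are translates of the one starting at its left end.\<close>
lemma frac_on_arc:
  fixes x :: real
  assumes "finite I" "j \<in> I" "frac (x - \<theta> i) < arc_length \<theta> I i"
  shows "frac (x - \<theta> j) = frac (x - \<theta> i) + frac (\<theta> i - \<theta> j)"
proof (cases "i = j")
  case False
  have "frac (x - \<theta> i) < frac (- (\<theta> i - \<theta> j))"
    using assms(2,3) False unfolding less_arc_length_iff[OF assms(1)] by auto
  hence "frac (x - \<theta> i) + frac (\<theta> i - \<theta> j) < 1"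
    by (smt (verit) frac_ge_0 frac_neg)
  thus ?thesis using frac_add[of "x - \<theta> i" "\<theta> i - \<theta> j"] by simp
qed simp

lemma limit_density_sum_frac:
  fixes \<alpha> c \<sigma> :: real and \<theta> :: "nat \<Rightarrow> real"
  assumes irr: "\<alpha> \<notin> \<rat>" and q: "q \<ge> 1" and \<sigma>: "\<sigma> \<noteq> 0"
    and dist: "\<And>i j. i \<in> {1..q} \<Longrightarrow> j \<in> {1..q} \<Longrightarrow> i \<noteq> j \<Longrightarrow> \<theta> i - \<theta> j \<notin> \<int>"
    and E: "\<And>n. E n = c + \<sigma> * (\<Sum>i=1..q. frac (real n * \<alpha> - \<theta> i))"
  shows "\<exists>f. has_limit_density E f \<and> weighted_average_of_uniforms q f"
proof -
  define w where "w = arc_length \<theta> {1..q}"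
  define e where "e = (\<lambda>i. c + \<sigma> * (\<Sum>j=1..q. frac (\<theta> i - \<theta> j)))"
  define \<kappa> where "\<kappa> = \<sigma> * real q"
  have \<kappa>: "\<kappa> \<noteq> 0" using \<sigma> q by (simp add: \<kappa>_def)
  have w: "0 < w i \<and> w i \<le> 1" if "i \<in> {1..q}" for i
    unfolding w_def using arc_length_bounds[of "{1..q}" i \<theta>] that dist by blast
  have part: "\<exists>!i. i \<in> {1..q} \<and> frac (real n * \<alpha> - \<theta> i) < w i" for n
    unfolding w_def by (rule ex1_arc) (use q dist in auto)
  have lin: "E n = e i + \<kappa> * frac (real n * \<alpha> - \<theta> i)"
    if "frac (real n * \<alpha> - \<theta> i) < w i" for n i
  proof -
    have "(\<Sum>j=1..q. frac (real n * \<alpha> - \<theta> j)) = (\<Sum>j=1..q. frac (real n * \<alpha> - \<theta> i) + frac (\<theta> i - \<theta> j))"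
      by (intro sum.cong refl frac_on_arc[of "{1..q}"]) (use that in \<open>auto simp: w_def\<close>)
    thus ?thesis by (simp add: E e_def \<kappa>_def sum.distrib algebra_simps)
  qed
  note * = limit_density_piecewise_linear[OF irr \<kappa> w part lin]
  have "l < u" if "i \<in> {1..q}" "l = e i + min 0 (\<kappa> * w i)" "u = e i + max 0 (\<kappa> * w i)" for i l u
  proof -
    have "\<kappa> * w i \<noteq> 0" using w[OF that(1)] \<kappa> by auto
    thus ?thesis using that(2,3) by linarith
  qed
  hence "weighted_average_of_uniforms q (\<lambda>x. \<Sum>i=1..q. w i *
            uniform_density (e i + min 0 (\<kappa> * w i)) (e i + max 0 (\<kappa> * w i)) x)"
    unfolding weighted_average_of_uniforms_def using *(1) w
    by (intro exI[of _ w] exI[of _ "\<lambda>i. e i + min 0 (\<kappa> * w i)"] exI[of _ "\<lambda>i. e i + max 0 (\<kappa> * w i)"])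
      (auto simp: less_imp_le)
  with *(2) show ?thesis by blast
qed

lemma limit_density_frac:
  fixes \<alpha> \<kappa> :: real
  assumes "\<alpha> \<notin> \<rat>" "\<kappa> \<noteq> 0" "\<And>n. E n = \<kappa> * frac (real n * \<alpha>)"
  shows "has_limit_density E (uniform_density (min 0 \<kappa>) (max 0 \<kappa>))"
  using limit_density_piecewise_linear(2)[of \<alpha> \<kappa> 1 "\<lambda>_. 1" "\<lambda>_. 0" E "\<lambda>_. 0"] assms
  by (simp add: frac_lt_1)

section \<open>Leading digits as codings of a rotation\<close>
lemma benford_length_bounds:
  assumes "d \<in> {1..9::nat}"
  shows "0 < log 10 (1 + 1 / real d)" "log 10 (1 + 1 / real d) < 1"
proof -
  have d: "0 < 1 / real d" "1 / real d \<le> 1" using assms by auto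
  show "0 < log 10 (1 + 1 / real d)" using d by (subst zero_less_log_cancel_iff) linarith+
  have "log 10 (1 + 1 / real d) < log 10 10" using d by (subst log_less_cancel_iff) linarith+
  thus "log 10 (1 + 1 / real d) < 1" by simp
qed

lemma log_Suc_digit:
  assumes "d \<in> {1..9::nat}"
  shows "log 10 (real d + 1) = log 10 (real d) + log 10 (1 + 1 / real d)"
proof -
  have d: "real d > 0" "1 + 1 / real d > 0" using assms by (auto intro: add_pos_nonneg)
  have "real d + 1 = real d * (1 + 1 / real d)" using d(1) by (simp add: field_simps)
  thus ?thesis using d by (simp add: log_mult)
qed

lemma log_mult_powi:
  fixes c :: real
  assumes "c > 0"
  shows "log 10 (c * 10 powi i) = log 10 c + of_int i"
proof -
  have "(10::real) powi i = 10 powr of_int i" by (simp add: powr_real_of_int')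
  thus ?thesis using assms by (simp add: log_mult)
qed

lemma has_leading_digit_iff_frac_log:
  assumes x: "x > 0" and d: "d \<in> {1..9}"
  shows "has_leading_digit x d \<longleftrightarrow> frac (log 10 x - log 10 (real d)) < log 10 (1 + 1 / real d)"
proof -
  define y where "y = log 10 x - log 10 (real d)"
  define l where "l = log 10 (1 + 1 / real d)"
  have d0: "real d \<ge> 1" using d by simp
  have l1: "l < 1" unfolding l_def using d by (rule benford_length_bounds)
  have lo: "real d * 10 powi i \<le> x \<longleftrightarrow> of_int i \<le> y" for i
    using x d0 log_le_cancel_iff[of 10 "real d * 10 powi i" x] log_mult_powi[of "real d" i]
    by (auto simp: y_def)
  have "log 10 (real d + 1) = log 10 (real d) + l"
    unfolding l_def using d by (rule log_Suc_digit)
  hence hi: "x < (real d + 1) * 10 powi i \<longleftrightarrow> y < of_int i + l" for i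
    using x d0 log_less_cancel_iff[of 10 x "(real d + 1) * 10 powi i"] log_mult_powi[of "real d + 1" i]
    by (auto simp: y_def)
  have "(\<exists>i. of_int i \<le> y \<and> y < of_int i + l) \<longleftrightarrow> frac y < l"
  proof
    assume "\<exists>i. of_int i \<le> y \<and> y < of_int i + l"
    then obtain i where i: "of_int i \<le> y" "y < of_int i + l" by blast
    hence "\<lfloor>y\<rfloor> = i" using l1 by linarith
    thus "frac y < l" using i by (simp add: frac_def)
  next
    assume "frac y < l"
    thus "\<exists>i. of_int i \<le> y \<and> y < of_int i + l"
      by (intro exI[of _ "\<lfloor>y\<rfloor>"]) (simp add: frac_def algebra_simps)
  qed
  thus ?thesis using d unfolding has_leading_digit_def lo hi by (simp add: y_def l_def)
qed

lemma leading_digit_power_iff: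
  assumes "a > 0" "d \<in> {1..9}"
  shows "leading_digit (a ^ n) = d
     \<longleftrightarrow> frac (real n * log 10 a - log 10 (real d)) < log 10 (1 + 1 / real d)"
  using assms leading_digit_eq_iff[of "a ^ n" d] has_leading_digit_iff_frac_log[of "a ^ n" d]
  by (simp add: log_nat_power)

lemma benford_count_power:
  assumes "a > 0" "d \<in> {1..9}"
  shows "real (benford_count d N (\<lambda>n. a ^ n))
     = (\<Sum>n=1..N. arc_indicator (log 10 (real d)) (log 10 (1 + 1 / real d)) (real n * log 10 a))"
  unfolding benford_count_def leading_digit_power_iff[OF assms] sum_arc_indicator_eq_card ..

lemma benford_error_power:
  assumes "a > 0" "d \<in> {1..9}"
  shows "benford_error d N (\<lambda>n. a ^ n)
     = (\<Sum>n=1..N. arc_indicator (log 10 (real d)) (log 10 (1 + 1 / real d)) (real n * log 10 a))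
       - real N * log 10 (1 + 1 / real d)"
  unfolding benford_error_def benford_prediction_def benford_count_power[OF assms] ..

lemma eq_mult_powi_iff_log:
  fixes x c :: real
  assumes "x > 0" "c > 0"
  shows "x = c * 10 powi m \<longleftrightarrow> log 10 x = log 10 c + of_int m"
proof -
  note log_mult_powi[OF assms(2), of m]
  moreover have "x = c * 10 powi m \<longleftrightarrow> log 10 x = log 10 (c * 10 powi m)"
    using assms inj_onD[OF log_inj[of 10], of x "c * 10 powi m"] by auto
  ultimately show ?thesis by simp
qed

lemma powi_eq_iff_length:
  fixes a :: real
  assumes "a > 0" "d \<in> {1..9::nat}"
  shows "a powi k = (real d + 1) / real d * 10 powi m
     \<longleftrightarrow> log 10 (1 + 1 / real d) = of_int k * log 10 a + of_int (- m)"
proof -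
  have d0: "real d \<ge> 1" using assms by simp
  have "log 10 (a powi k) = of_int k * log 10 a" 
    using assms by (simp add: powr_real_of_int'[symmetric] log_powr)
  moreover have "(real d + 1) / real d = 1 + 1 / real d" "1 + 1 / real d > 0"
    using d0 by (simp_all add: field_simps)
  moreover have "a powi k > 0" using assms by simp
  ultimately show ?thesis
    using eq_mult_powi_iff_log[of "a powi k" "1 + 1 / real d" m] by (simp only:) linarith
qed

lemma not_Ints_mult_irrational:
  fixes \<alpha> :: real
  assumes "\<alpha> \<notin> \<rat>" "k \<noteq> (0 :: int)"
  shows "of_int k * \<alpha> \<notin> \<int>"
proof
  assume "of_int k * \<alpha> \<in> \<int>"
  then obtain m where "of_int k * \<alpha> = of_int m" by (auto elim: Ints_cases)
  hence "\<alpha> = of_int m / of_int k" using assms(2) by (simp add: field_simps)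
  thus False using assms(1) by simp
qed

text \<open>The breakpoints of the sawtooths are translates of \<open>s\<close> by \<open>\<bar>k\<bar>\<close> different multiples of \<open>\<alpha>\<close>,
hence distinct modulo 1 by irrationality.\<close>
lemma limit_density_discrepancy:
  fixes \<alpha> s l :: real and k m :: int
  assumes irr: "\<alpha> \<notin> \<rat>" and l: "0 < l" "l < 1" "l = of_int k * \<alpha> + of_int m" and k: "k \<noteq> 0"
  shows "\<exists>f. has_limit_density (\<lambda>N. (\<Sum>n=1..N. arc_indicator s l (real n * \<alpha>)) - real N * l) f
      \<and> weighted_average_of_uniforms (nat \<bar>k\<bar>) f"
proof -
  define b where "b = (if k > 0 then 1 else 1 - k)"
  define \<theta> where "\<theta> = (\<lambda>i. s - of_int (b - int i) * \<alpha>)"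
  show ?thesis
  proof (rule limit_density_sum_frac[OF irr])
    show "nat \<bar>k\<bar> \<ge> 1" "- sgn (real_of_int k) \<noteq> 0" using k by (auto simp: sgn_if)
    show "\<theta> i - \<theta> j \<notin> \<int>" if "i \<noteq> j" for i j
      using not_Ints_mult_irrational[OF irr, of "int i - int j"] that
      by (simp add: \<theta>_def algebra_simps)
    show "(\<Sum>n=1..N. arc_indicator s l (real n * \<alpha>)) - real N * l
        = sgn (of_int k) * (\<Sum>i=1..nat \<bar>k\<bar>. frac (of_int (b - int i) * \<alpha> - s))
          + - sgn (of_int k) * (\<Sum>i=1..nat \<bar>k\<bar>. frac (real N * \<alpha> - \<theta> i))" for N
      unfolding discrepancy_eq_sum_frac[OF l] b_def[symmetric]
      by (simp add: \<theta>_def algebra_simps)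
  qed
qed

section \<open>Rigidity of codings by floors and ceilings\<close>

text \<open>The successive differences of \<open>\<lfloor>n l\<rfloor>\<close> and \<open>\<lceil>n l\<rceil>\<close> are values of this arc indicator.\<close>
lemma arc_indicator_eq_floor_diff:
  assumes "0 < l" "l < 1"
  shows "arc_indicator 0 l x = of_int (\<lfloor>x\<rfloor> - \<lfloor>x - l\<rfloor>)"
  using arc_indicator_eq[OF assms, of 0 x] by (simp add: frac_def)

lemma eventually_scaled_arc_indicator_at_right:
  assumes "c > 0"
  shows "\<forall>\<^sub>F y in at_right x. arc_indicator s l (c * y) = arc_indicator s l (c * x)"
proof -
  obtain b where b: "b > c * x"
    "\<And>y. c * x < y \<Longrightarrow> y < b \<Longrightarrow> arc_indicator s l y = arc_indicator s l (c * x)"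
    using eventually_arc_indicator_at_right[where x = "c * x" and s = s and l = l]
    by (auto simp: eventually_at_right_field)
  show ?thesis unfolding eventually_at_right_field
    using b assms by (intro exI[of _ "b / c"]) (auto simp: field_simps)
qed

lemma arc_indicator_inside: "0 \<le> x \<Longrightarrow> x < l \<Longrightarrow> l \<le> 1 \<Longrightarrow> arc_indicator 0 l x = 1"
  by (simp add: arc_indicator_def frac_eq_id)

lemma arc_indicator_below_0:
  assumes "l - 1 \<le> x" "x < 0" "0 \<le> l"
  shows "arc_indicator 0 l x = 0"
proof -
  have "frac x = x + 1" using assms frac_1_eq[of x] frac_eq[of "x + 1"] by simp
  thus ?thesis using assms by (simp add: arc_indicator_def)
qed

lemma arc_indicator_at_end: "0 < l \<Longrightarrow> l < 1 \<Longrightarrow> arc_indicator 0 l l = 0"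
  by (simp add: arc_indicator_def frac_eq_id)

text \<open>By right-continuity the two codings agree at every point of the line, not only on the orbit. Near
\<open>0\<close> the right-hand side jumps from \<open>0\<close> to \<open>1\<close>, so \<open>0\<close> is the left end of the arc on the left-hand
side, whence \<open>s\<close> is an integer. The arc now starts at \<open>0\<close> and has length \<open>l\<close>, but for \<open>q \<ge> 2\<close> the
right-hand side already drops to \<open>0\<close> at \<open>l / q < l\<close>.\<close>
lemma arc_coding_rigid:
  fixes \<alpha> s l :: real and q :: nat
  assumes irr: "\<alpha> \<notin> \<rat>" and l: "0 < l" "l < 1" and q: "q \<ge> 1"
    and coding: "\<And>n. n \<ge> 1 \<Longrightarrow> arc_indicator s l (real n * \<alpha>) = arc_indicator 0 l (real q * (real n * \<alpha>))"
  shows "s \<in> \<int>" and "q = 1"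
proof -
  have everywhere: "arc_indicator s l x = arc_indicator 0 l (real q * x)" for x
  proof -
    have "\<forall>\<^sub>F y in at_right x. arc_indicator s l y = arc_indicator s l x
        \<and> arc_indicator 0 l (real q * y) = arc_indicator 0 l (real q * x)"
      using q by (intro eventually_conj eventually_arc_indicator_at_right
          eventually_scaled_arc_indicator_at_right) auto
    then obtain n h where n: "n \<ge> 1"
      "arc_indicator s l (real n * \<alpha> + of_int h) = arc_indicator s l x"
      "arc_indicator 0 l (real q * (real n * \<alpha> + of_int h)) = arc_indicator 0 l (real q * x)"
      using orbit_approaches_from_right[OF irr] by blast
    have "real q * (real n * \<alpha> + of_int h) = real q * (real n * \<alpha>) + of_int (int q * h)"
      by (simp add: algebra_simps)
    thus ?thesis using n coding[of n] by (simp only: arc_indicator_add_of_int)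
  qed
  show s: "s \<in> \<int>"
  proof (rule ccontr)
    assume "s \<notin> \<int>"
    hence pos: "frac (- s) > 0" by simp
    have "arc_indicator s l 0 = 1" using everywhere[of 0] l by (simp add: arc_indicator_inside)
    hence fs: "frac (- s) < l" by (simp add: arc_indicator_def split: if_splits)
    define \<epsilon> where "\<epsilon> = min (frac (- s)) ((1 - l) / real q)"
    have \<epsilon>: "\<epsilon> > 0" "\<epsilon> \<le> frac (- s)" "real q * \<epsilon> \<le> 1 - l"
      using pos l q by (auto simp: \<epsilon>_def min_def field_simps)
    have "frac (- \<epsilon> - s) = frac (- s) - \<epsilon>"
      unfolding frac_unique_iff
    proof (intro conjI)
      show "- \<epsilon> - s - (frac (- s) - \<epsilon>) \<in> \<int>" by (simp add: frac_def)
    qed (use \<epsilon> frac_lt_1[of "- s"] in linarith)+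
    hence "arc_indicator s l (- \<epsilon>) = 1" using fs \<epsilon> by (simp add: arc_indicator_def)
    moreover have "arc_indicator 0 l (real q * - \<epsilon>) = 0"
      using \<epsilon> q l by (intro arc_indicator_below_0) auto
    ultimately show False using everywhere[of "- \<epsilon>"] by simp
  qed
  show "q = 1"
  proof (rule ccontr)
    assume "q \<noteq> 1"
    hence q2: "real q \<ge> 2" using q by simp
    hence "l / real q < l" using l by (simp add: divide_less_eq)
    hence in1: "arc_indicator 0 l (l / real q) = 1" using l by (intro arc_indicator_inside) auto
    obtain z where z: "s = of_int z" using s by (auto elim: Ints_cases)
    have "arc_indicator s l (l / real q) = arc_indicator 0 l (l / real q)"
      unfolding arc_indicator_def z using frac_add_of_int[of "l / real q" "- z"] by simp
    hence "arc_indicator 0 l (real q * (l / real q)) = 1" using in1 everywhere by simp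
    thus False using arc_indicator_at_end[OF l] q2 by simp
  qed
qed

text \<open>A negative \<open>k\<close> is excluded at \<open>\<alpha>\<close>: at orbit points just to the right of \<open>\<alpha>\<close>, the coding on the
right-hand side is evaluated, modulo 1, just below \<open>l\<close>, giving \<open>1\<close>, while at \<open>\<alpha>\<close> itself it is
evaluated at \<open>l\<close>, giving \<open>0\<close>. The left-hand side does not jump when approached from the right.\<close>
lemma lower_coding_rigid:
  fixes \<alpha> s l :: real and k m :: int
  assumes irr: "\<alpha> \<notin> \<rat>" and l: "0 < l" "l < 1" "l = of_int k * \<alpha> + of_int m"
    and coding: "\<And>n. n \<ge> 1 \<Longrightarrow> arc_indicator s l (real n * \<alpha>) = arc_indicator 0 l (real n * l)"
  shows "s \<in> \<int>" and "k = 1"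
proof -
  have coding_k: "arc_indicator s l (real n * \<alpha>) = arc_indicator 0 l (of_int k * (real n * \<alpha>))"
    if "n \<ge> 1" for n
  proof -
    have "real n * l = of_int k * (real n * \<alpha>) + of_int (int n * m)"
      by (simp add: l(3) algebra_simps)
    thus ?thesis using coding[OF that] by (simp only: arc_indicator_add_of_int)
  qed
  have "k \<noteq> 0"
  proof
    assume "k = 0"
    thus False using l by auto
  qed
  moreover have "\<not> k < 0"
  proof
    assume "k < 0"
    have "\<forall>\<^sub>F y in at_right \<alpha>. arc_indicator s l y = arc_indicator s l \<alpha>
        \<and> \<alpha> < y \<and> y < \<alpha> + l / of_int (- k)"
      using l(1) \<open>k < 0\<close>
      by (intro eventually_conj eventually_arc_indicator_at_right)
        (auto simp: eventually_at_right_field divide_less_0_iff intro!: exI[of _ "\<alpha> - l / of_int k"])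
    then obtain n h where n: "n \<ge> 1"
      and "arc_indicator s l (real n * \<alpha> + of_int h) = arc_indicator s l \<alpha>"
        "\<alpha> < real n * \<alpha> + of_int h" "real n * \<alpha> + of_int h < \<alpha> + l / of_int (- k)"
      using orbit_approaches_from_right[OF irr] by blast
    define y where "y = real n * \<alpha> + of_int h"
    have y: "arc_indicator s l y = arc_indicator s l \<alpha>" "\<alpha> < y" "y < \<alpha> + l / of_int (- k)"
      unfolding y_def by fact+
    have "arc_indicator 0 l (of_int k * (real n * \<alpha>)) = 1"
    proof -
      have eq: "of_int k * (real n * \<alpha>) = (l + of_int k * (y - \<alpha>)) + of_int (- m - k * h)"
        by (simp add: y_def l(3) algebra_simps)
      have "of_int k * (y - \<alpha>) < 0" using y(2) \<open>k < 0\<close> by (simp add: mult_neg_pos)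
      moreover have "- l < of_int k * (y - \<alpha>)" using y(3) \<open>k < 0\<close> by (simp add: field_simps)
      ultimately show ?thesis
        unfolding eq arc_indicator_add_of_int using l by (intro arc_indicator_inside) linarith+
    qed
    hence "arc_indicator s l \<alpha> = 1"
      using coding_k[OF n] y(1) arc_indicator_add_of_int[of s l "real n * \<alpha>" h] by (simp add: y_def)
    moreover have "arc_indicator s l \<alpha> = 0"
      using coding[of 1] arc_indicator_at_end[OF l(1,2)] by simp
    ultimately show False by simp
  qed
  ultimately have k: "k > 0" by linarith
  have "s \<in> \<int>" "nat k = 1"
    using arc_coding_rigid[OF irr l(1,2), of "nat k" s] k coding_k by auto
  thus "s \<in> \<int>" "k = 1" using k by auto
qed

text \<open>Here \<open>n = 0\<close> is included, and a positive \<open>k\<close> is excluded at \<open>0\<close>: the right-hand side is \<open>1\<close> at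
\<open>0\<close>, but at orbit points just to the right of \<open>0\<close> it is evaluated just below \<open>0\<close>, giving \<open>0\<close>.\<close>
lemma upper_coding_rigid:
  fixes \<alpha> s l :: real and k m :: int
  assumes irr: "\<alpha> \<notin> \<rat>" and l: "0 < l" "l < 1" "l = of_int k * \<alpha> + of_int m"
    and coding: "\<And>n. arc_indicator s l (real n * \<alpha>) = arc_indicator 0 l (- (real n * l))"
  shows "s \<in> \<int>" and "k = - 1"
proof -
  have coding_k: "arc_indicator s l (real n * \<alpha>) = arc_indicator 0 l (of_int (- k) * (real n * \<alpha>))" for n
  proof -
    have "- (real n * l) = of_int (- k) * (real n * \<alpha>) + of_int (- int n * m)"
      by (simp add: l(3) algebra_simps)
    thus ?thesis using coding[of n] by (simp only: arc_indicator_add_of_int)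
  qed
  have "k \<noteq> 0"
  proof
    assume "k = 0"
    thus False using l by auto
  qed
  moreover have "\<not> k > 0"
  proof
    assume "k > 0"
    have "\<forall>\<^sub>F y in at_right 0. arc_indicator s l y = arc_indicator s l 0
        \<and> 0 < y \<and> y < (1 - l) / of_int k"
      using l(2) \<open>k > 0\<close>
      by (intro eventually_conj eventually_arc_indicator_at_right)
        (auto simp: eventually_at_right_field intro!: exI[of _ "(1 - l) / of_int k"])
    then obtain n h where "arc_indicator s l (real n * \<alpha> + of_int h) = arc_indicator s l 0"
        "0 < real n * \<alpha> + of_int h" "real n * \<alpha> + of_int h < (1 - l) / of_int k"
      using orbit_approaches_from_right[OF irr, where M = 0] by blast
    moreover define y where "y = real n * \<alpha> + of_int h"
    ultimately have y: "arc_indicator s l y = arc_indicator s l 0" "0 < y" "y < (1 - l) / of_int k"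
      by simp_all
    have "arc_indicator 0 l (of_int (- k) * (real n * \<alpha>)) = 0"
    proof -
      have eq: "of_int (- k) * (real n * \<alpha>) = - (of_int k * y) + of_int (k * h)"
        by (simp add: y_def algebra_simps)
      have "of_int k * y > 0" using y(2) \<open>k > 0\<close> by simp
      moreover have "of_int k * y < 1 - l" using y(3) \<open>k > 0\<close> by (simp add: field_simps)
      ultimately show ?thesis
        unfolding eq arc_indicator_add_of_int using l by (intro arc_indicator_below_0) linarith+
    qed
    hence "arc_indicator s l 0 = 0"
      using coding_k[of n] y(1) arc_indicator_add_of_int[of s l "real n * \<alpha>" h] by (simp add: y_def)
    moreover have "arc_indicator s l 0 = 1"
      using coding[of 0] l by (simp add: arc_indicator_inside)
    ultimately show False by simp
  qed
  ultimately have k: "k < 0" by linarith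
  have "s \<in> \<int>" "nat (- k) = 1"
    using arc_coding_rigid[OF irr l(1,2), of "nat (- k)" s] k coding_k by auto
  thus "s \<in> \<int>" "k = - 1" using k by auto
qed

section \<open>Bounded error and perfect hits for powers\<close>

text \<open>Here \<open>l = \<alpha> - m\<close>, so a single sawtooth starting at \<open>s = 0\<close> remains, and modulo 1 its argument is
the prediction itself.\<close>
lemma error_power_digit_1:
  fixes a :: real
  assumes "a = 2 * 10 powi m"
  shows "benford_error 1 N (\<lambda>n. a ^ n) = - frac (real N * log 10 a)"
    and "benford_error 1 N (\<lambda>n. a ^ n) = - frac (benford_prediction 1 N)"
proof -
  have a: "a > 0" using assms by simp
  have log_a: "log 10 a = log 10 2 + of_int m" using eq_mult_powi_iff_log[of a 2 m] assms a by simp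
  have l: "(0::real) < log 10 2" "log 10 (2::real) < 1"
    "log 10 2 = of_int 1 * log 10 a + of_int (- m)" by (simp_all add: log_a)
  show err: "benford_error 1 N (\<lambda>n. a ^ n) = - frac (real N * log 10 a)"
    using discrepancy_eq_sum_frac[OF l, of 0 N] benford_error_power[OF a, of 1 N] by simp
  have "frac (real N * log 10 a) = frac (real N * log 10 2)"
    using frac_add_of_int[of "real N * log 10 2" "int N * m"] by (simp add: log_a algebra_simps)
  thus "benford_error 1 N (\<lambda>n. a ^ n) = - frac (benford_prediction 1 N)"
    using err by (simp add: benford_prediction_def)
qed

text \<open>Here \<open>l = - \<alpha> + (1 + m)\<close>, so the telescoped sum is one sawtooth with the opposite sign, shifted by
one step; the shift by \<open>\<alpha>\<close> cancels the starting point \<open>s = log 10 9\<close> modulo 1.\<close>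
lemma error_power_digit_9:
  fixes a :: real
  assumes "a = 9 * 10 powi m"
  shows "benford_error 9 N (\<lambda>n. a ^ n) = frac (real N * log 10 a)"
    and "benford_error 9 N (\<lambda>n. a ^ n) = frac (- benford_prediction 9 N)"
proof -
  have a: "a > 0" using assms by simp
  have log_a: "log 10 a = log 10 9 + of_int m" using eq_mult_powi_iff_log[of a 9 m] assms a by simp
  define l where "l = log 10 (1 + 1 / real 9)"
  have "log 10 (10 / 9) = 1 - log 10 (9::real)" by (simp add: log_divide)
  hence l_eq: "l = 1 - log 10 9" by (simp add: l_def)
  have l: "0 < l" "l < 1" "l = of_int (- 1) * log 10 a + of_int (1 + m)"
    using benford_length_bounds[of 9] unfolding l_def[symmetric] by (simp_all add: log_a l_eq)
  have "benford_error 9 N (\<lambda>n. a ^ n)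
      = (\<Sum>n=1..N. arc_indicator (log 10 9) l (real n * log 10 a)) - real N * l"
    using benford_error_power[OF a, of 9 N] by (simp add: l_def)
  also have "\<dots> = frac (real N * log 10 a + of_int m)"
    unfolding discrepancy_eq_sum_frac[OF l] by (simp add: log_a algebra_simps)
  finally show err: "benford_error 9 N (\<lambda>n. a ^ n) = frac (real N * log 10 a)"
    by (simp only: frac_add_of_int)
  have "real N * log 10 a = - (real N * l) + of_int (int N * (1 + m))"
    by (simp add: log_a l_eq algebra_simps)
  hence "frac (real N * log 10 a) = frac (- (real N * l))"
    by (simp only: frac_add_of_int)
  thus "benford_error 9 N (\<lambda>n. a ^ n) = frac (- benford_prediction 9 N)"
    using err by (simp add: benford_prediction_def l_def)
qed

lemma lower_perfect_hit_digit_1: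
  fixes a :: real
  assumes "a = 2 * 10 powi m"
  shows "lower_perfect_hit 1 (\<lambda>n. a ^ n)"
  unfolding lower_perfect_hit_def
proof (intro allI impI)
  fix N
  have "real (benford_count 1 N (\<lambda>n. a ^ n)) = of_int \<lfloor>benford_prediction 1 N\<rfloor>"
    using error_power_digit_1(2)[OF assms, of N] by (simp add: benford_error_def frac_def)
  thus "int (benford_count 1 N (\<lambda>n. a ^ n)) = \<lfloor>benford_prediction 1 N\<rfloor>" by linarith
qed

lemma upper_perfect_hit_digit_9:
  fixes a :: real
  assumes "a = 9 * 10 powi m"
  shows "upper_perfect_hit 9 (\<lambda>n. a ^ n)"
  unfolding upper_perfect_hit_def
proof (intro allI impI)
  fix N
  have "real (benford_count 9 N (\<lambda>n. a ^ n)) = of_int \<lceil>benford_prediction 9 N\<rceil>"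
    using error_power_digit_9(2)[OF assms, of N]
    by (simp add: benford_error_def frac_def ceiling_def)
  thus "int (benford_count 9 N (\<lambda>n. a ^ n)) = \<lceil>benford_prediction 9 N\<rceil>" by linarith
qed

lemma benford_count_power_Suc:
  assumes "a > 0" "d \<in> {1..9}"
  shows "arc_indicator (log 10 (real d)) (log 10 (1 + 1 / real d)) (real (Suc n) * log 10 a)
    = real (benford_count d (Suc n) (\<lambda>n. a ^ n)) - real (benford_count d n (\<lambda>n. a ^ n))"
  unfolding benford_count_power[OF assms] by simp

lemma bounded_benford_error_power_iff:
  fixes a :: real
  assumes a: "a > 0" and irr: "log 10 a \<notin> \<rat>" and d: "d \<in> {1..9}"
  shows "bounded_benford_error d (\<lambda>n. a ^ n) \<longleftrightarrow>
    (\<exists>k m :: int. k \<noteq> 0 \<and> log 10 (1 + 1 / real d) = of_int k * log 10 a + of_int m)"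
proof
  note l = benford_length_bounds[OF d]
  assume "bounded_benford_error d (\<lambda>n. a ^ n)"
  then obtain C where C: "\<And>N. N \<ge> 1 \<Longrightarrow> \<bar>benford_error d N (\<lambda>n. a ^ n)\<bar> \<le> C"
    unfolding bounded_benford_error_def by blast
  have "\<bar>benford_error d N (\<lambda>n. a ^ n)\<bar> \<le> \<bar>C\<bar>" for N
    using C[of N] by (cases "N = 0") (auto simp: benford_error_power[OF a d])
  then obtain k m where km: "log 10 (1 + 1 / real d) = of_int k * log 10 a + of_int m"
    using kesten_arc_length[OF irr l] unfolding benford_error_power[OF a d] by blast
  moreover have "k \<noteq> 0"
  proof
    assume "k = 0"
    thus False using km l by auto
  qed
  ultimately show "\<exists>k m :: int. k \<noteq> 0 \<and> log 10 (1 + 1 / real d) = of_int k * log 10 a + of_int m"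
    by blast
next
  note l = benford_length_bounds[OF d]
  assume "\<exists>k m :: int. k \<noteq> 0 \<and> log 10 (1 + 1 / real d) = of_int k * log 10 a + of_int m"
  then obtain k m :: int where "log 10 (1 + 1 / real d) = of_int k * log 10 a + of_int m" by blast
  thus "bounded_benford_error d (\<lambda>n. a ^ n)"
    unfolding bounded_benford_error_def benford_error_power[OF a d]
    using discrepancy_bounded[OF l] by blast
qed

lemma lower_perfect_hitD:
  fixes a :: real
  assumes a: "a > 0" and irr: "log 10 a \<notin> \<rat>" and d: "d \<in> {1..9}"
    and hit: "lower_perfect_hit d (\<lambda>n. a ^ n)"
  shows "d = 1 \<and> (\<exists>m :: int. a = 2 * 10 powi m)"
proof -
  define s where "s = log 10 (real d)"
  define l where "l = log 10 (1 + 1 / real d)"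
  have l: "0 < l" "l < 1" using benford_length_bounds[OF d] by (simp_all add: l_def)
  have count: "real (benford_count d N (\<lambda>n. a ^ n)) = of_int \<lfloor>real N * l\<rfloor>" for N
  proof (cases "N = 0")
    case False
    hence "int (benford_count d N (\<lambda>n. a ^ n)) = \<lfloor>real N * l\<rfloor>"
      using hit by (simp add: lower_perfect_hit_def benford_prediction_def l_def)
    thus ?thesis by linarith
  qed (simp add: benford_count_def)
  have "\<bar>benford_error d N (\<lambda>n. a ^ n)\<bar> \<le> 1" for N
    using count[of N] unfolding benford_error_def benford_prediction_def l_def[symmetric] by linarith
  hence "bounded_benford_error d (\<lambda>n. a ^ n)" unfolding bounded_benford_error_def by blast
  then obtain k m where km: "l = of_int k * log 10 a + of_int m"
    unfolding bounded_benford_error_power_iff[OF a irr d] l_def by blast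
  have coding: "arc_indicator s l (real n * log 10 a) = arc_indicator 0 l (real n * l)" if n: "n \<ge> 1" for n
  proof -
    obtain n' where n': "n = Suc n'" using n by (cases n) auto
    have "arc_indicator s l (real n * log 10 a) = of_int (\<lfloor>real n * l\<rfloor> - \<lfloor>real n' * l\<rfloor>)"
      using benford_count_power_Suc[OF a d, of n'] unfolding n' s_def l_def[symmetric] count by simp
    moreover have "real n' * l = real n * l - l" by (simp add: n' algebra_simps)
    ultimately show ?thesis using arc_indicator_eq_floor_diff[OF l, of "real n * l"] by simp
  qed
  have "s \<in> \<int>" and k: "k = 1" using lower_coding_rigid[OF irr l km coding] by blast+
  moreover have "0 \<le> s" "s < 1" using d by (auto simp: s_def)
  ultimately have "s = 0" by (auto elim!: Ints_cases)
  hence "d = 1" using d inj_onD[OF log_inj[of 10], of "real d" 1] by (simp add: s_def)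
  moreover have "a = 2 * 10 powi (- m)"
    using km a eq_mult_powi_iff_log[of a 2 "- m"] by (simp add: l_def k \<open>d = 1\<close>)
  ultimately show ?thesis by blast
qed

text \<open>The difference \<open>\<lceil>(n + 1) l\<rceil> - \<lceil>n l\<rceil>\<close> codes the point \<open>- n l\<close> but tells the digit of \<open>a ^ (n + 1)\<close>; this
moves the arc from \<open>\<beta>\<close> to \<open>\<beta> - \<alpha>\<close>. With \<open>k = -1\<close>, integrality of \<open>\<beta> - \<alpha>\<close> makes
\<open>log 10 (d + 1) = \<beta> + l\<close> an integer, which leaves \<open>d = 9\<close>.\<close>
lemma upper_perfect_hitD:
  fixes a :: real
  assumes a: "a > 0" and irr: "log 10 a \<notin> \<rat>" and d: "d \<in> {1..9}"
    and hit: "upper_perfect_hit d (\<lambda>n. a ^ n)"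
  shows "d = 9 \<and> (\<exists>m :: int. a = 9 * 10 powi m)"
proof -
  define \<alpha> where "\<alpha> = log 10 a"
  define \<beta> where "\<beta> = log 10 (real d)"
  define l where "l = log 10 (1 + 1 / real d)"
  have l: "0 < l" "l < 1" using benford_length_bounds[OF d] by (simp_all add: l_def)
  have count: "real (benford_count d N (\<lambda>n. a ^ n)) = of_int \<lceil>real N * l\<rceil>" for N
  proof (cases "N = 0")
    case False
    hence "int (benford_count d N (\<lambda>n. a ^ n)) = \<lceil>real N * l\<rceil>"
      using hit by (simp add: upper_perfect_hit_def benford_prediction_def l_def)
    thus ?thesis by linarith
  qed (simp add: benford_count_def)
  have "\<bar>benford_error d N (\<lambda>n. a ^ n)\<bar> \<le> 1" for N
    using count[of N] unfolding benford_error_def benford_prediction_def l_def[symmetric] by linarith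
  hence "bounded_benford_error d (\<lambda>n. a ^ n)" unfolding bounded_benford_error_def by blast
  then obtain k m where km: "l = of_int k * \<alpha> + of_int m"
    unfolding bounded_benford_error_power_iff[OF a irr d] l_def \<alpha>_def by blast
  have coding: "arc_indicator (\<beta> - \<alpha>) l (real n * \<alpha>) = arc_indicator 0 l (- (real n * l))" for n
  proof -
    have "arc_indicator (\<beta> - \<alpha>) l (real n * \<alpha>) = arc_indicator \<beta> l (real (Suc n) * \<alpha>)"
      by (simp add: arc_indicator_def algebra_simps)
    also have "\<dots> = of_int (\<lceil>real (Suc n) * l\<rceil> - \<lceil>real n * l\<rceil>)"
      using benford_count_power_Suc[OF a d, of n]
      unfolding \<alpha>_def \<beta>_def l_def[symmetric] count by simp
    also have "\<dots> = of_int (\<lfloor>- (real n * l)\<rfloor> - \<lfloor>- (real (Suc n) * l)\<rfloor>)"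
      by (simp add: ceiling_def)
    also have "- (real (Suc n) * l) = - (real n * l) - l" by (simp add: algebra_simps)
    finally show ?thesis using arc_indicator_eq_floor_diff[OF l, of "- (real n * l)"] by simp
  qed
  have irr': "\<alpha> \<notin> \<rat>" using irr by (simp add: \<alpha>_def)
  have s: "\<beta> - \<alpha> \<in> \<int>" and k: "k = - 1" using upper_coding_rigid[OF irr' l km coding] by blast+
  have sum: "log 10 (real d + 1) = \<beta> + l" unfolding l_def \<beta>_def using d by (rule log_Suc_digit)
  have "\<beta> + l = (\<beta> - \<alpha>) + of_int m" using km k by simp
  hence "log 10 (real d + 1) \<in> \<int>" using s sum by (metis Ints_add Ints_of_int)
  then obtain j where j: "log 10 (real d + 1) = of_int j" by (auto elim: Ints_cases)
  have "0 < log 10 (real d + 1)" "log 10 (real d + 1) \<le> 1" using d by auto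
  hence "j = 1" unfolding j by linarith
  hence "log 10 (real d + 1) = log 10 10" using j by simp
  hence "d = 9" using inj_onD[OF log_inj[of 10], of "real d + 1" 10] by simp
  moreover obtain z where "\<beta> - \<alpha> = of_int z" using s by (auto elim: Ints_cases)
  hence "a = 9 * 10 powi (- z)"
    using a eq_mult_powi_iff_log[of a 9 "- z"] by (simp add: \<alpha>_def \<beta>_def \<open>d = 9\<close>)
  ultimately show ?thesis by blast
qed

theorem theorem9:
  fixes a :: real and d :: nat
  assumes "a > 0" and "log 10 a \<notin> \<rat>" and "d \<in> {1..9}"
  shows
    "(bounded_benford_error d (\<lambda>n. a ^ n) \<longleftrightarrow>
        (\<exists>k m :: int. k \<noteq> 0 \<and> a powi k = (real d + 1) / real d * 10 powi m))
     \<and> (\<forall>k m :: int. k \<noteq> 0 \<and> a powi k = (real d + 1) / real d * 10 powi m \<longrightarrow>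
          (\<exists>f. has_limit_density (\<lambda>N. benford_error d N (\<lambda>n. a ^ n)) f \<and>
               weighted_average_of_uniforms (nat \<bar>k\<bar>) f))
     \<and> (lower_perfect_hit d (\<lambda>n. a ^ n) \<longleftrightarrow>
          d = 1 \<and> (\<exists>m :: int. a = 2 * 10 powi m))
     \<and> (upper_perfect_hit d (\<lambda>n. a ^ n) \<longleftrightarrow>
          d = 9 \<and> (\<exists>m :: int. a = 9 * 10 powi m))
     \<and> (d = 1 \<and> (\<exists>m :: int. a = 2 * 10 powi m) \<longrightarrow>
          has_limit_density (\<lambda>N. benford_error d N (\<lambda>n. a ^ n)) (uniform_density (-1) 0))
     \<and> (d = 9 \<and> (\<exists>m :: int. a = 9 * 10 powi m) \<longrightarrow>
          has_limit_density (\<lambda>N. benford_error d N (\<lambda>n. a ^ n)) (uniform_density 0 1))"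
proof (intro conjI)
  note length_iff = powi_eq_iff_length[OF assms(1,3)]
  show "bounded_benford_error d (\<lambda>n. a ^ n) \<longleftrightarrow>
        (\<exists>k m :: int. k \<noteq> 0 \<and> a powi k = (real d + 1) / real d * 10 powi m)"
    unfolding bounded_benford_error_power_iff[OF assms] length_iff by (metis minus_minus)
  show "\<forall>k m :: int. k \<noteq> 0 \<and> a powi k = (real d + 1) / real d * 10 powi m \<longrightarrow>
          (\<exists>f. has_limit_density (\<lambda>N. benford_error d N (\<lambda>n. a ^ n)) f \<and>
               weighted_average_of_uniforms (nat \<bar>k\<bar>) f)"
    unfolding length_iff benford_error_power[OF assms(1,3)]
    using limit_density_discrepancy[OF assms(2) benford_length_bounds[OF assms(3)]] by blast
  show "lower_perfect_hit d (\<lambda>n. a ^ n) \<longleftrightarrow> d = 1 \<and> (\<exists>m :: int. a = 2 * 10 powi m)"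
    using lower_perfect_hitD[OF assms] lower_perfect_hit_digit_1 by blast
  show "upper_perfect_hit d (\<lambda>n. a ^ n) \<longleftrightarrow> d = 9 \<and> (\<exists>m :: int. a = 9 * 10 powi m)"
    using upper_perfect_hitD[OF assms] upper_perfect_hit_digit_9 by blast
  show "d = 1 \<and> (\<exists>m :: int. a = 2 * 10 powi m) \<longrightarrow>
          has_limit_density (\<lambda>N. benford_error d N (\<lambda>n. a ^ n)) (uniform_density (-1) 0)"
  proof clarify
    fix m assume "a = 2 * 10 powi m" "d = 1"
    thus "has_limit_density (\<lambda>N. benford_error 1 N (\<lambda>n. (2 * 10 powi m) ^ n)) (uniform_density (-1) 0)"
      using limit_density_frac[OF assms(2), of "- 1"] error_power_digit_1(1)[of a m] by simp
  qed
  show "d = 9 \<and> (\<exists>m :: int. a = 9 * 10 powi m) \<longrightarrow>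
          has_limit_density (\<lambda>N. benford_error d N (\<lambda>n. a ^ n)) (uniform_density 0 1)"
  proof clarify
    fix m assume "a = 9 * 10 powi m" "d = 9"
    thus "has_limit_density (\<lambda>N. benford_error 9 N (\<lambda>n. (9 * 10 powi m) ^ n)) (uniform_density 0 1)"
      using limit_density_frac[OF assms(2), of 1] error_power_digit_9(1)[of a m] by simp
  qed
qed

end
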